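(* Let $G=(V,E)$ be a (connected) Eulerian digraph, and let $A$ be any totally unimodular matrix representing the oriented dual of the graphic matroid of $G$. Let $v_0$ be an arbitrary fixed vertex of $G$, and let $$\mathcal{D}=\{B\subset E \mid E-B \text{ is a spanning arborescence of } G \text{ rooted at } v_0\}.$$ Then $\{\Delta_B\mid B\in\mathcal{D}\}$ is a triangulation of $\mathcal{Q}_A$.
   Context: Digraphs are finite (multi)graphs with at least one edge; Eulerian digraphs are connected, and Eulerian means in-degree equals out-degree at every vertex. A tree in $G$ is a subgraph whose underlying undirected graph is connected and cycle-free. An arborescence rooted at $v_0$ is a tree $F$ containing $v_0$ in which every edge $e$ is oriented away from $v_0$ (its tail lies in the component of $F-e$ containing $v_0$). It is spanning if it contains all vertices. Spanning arborescences are identified with their edge sets. A matrix is totally unimodular if all its subdeterminants are in $\{0,1,-1\}$. For a totally unimodular matrix $A$ with columns $(a_i)_{i\in E}$ in $\mathbb{Z}^n$, a circuit is a minimal $C\subseteq E$ with $\{a_i\}_{i\in C}$ linearly dependent (as a family). A signed circuit is a pair $(C^+,C^-)$ with $C=C^+\sqcup C^-$ a circuit for which there is a linear dependence $\sum_{i\in C}\lambda_i a_i=0$ with $\lambda_i>0$ on $C^+$ and $\lambda_i<0$ on $C^-$. A cut of $G$ is the set of all edges joining $V_1$ and $V_2$ for a partition $V=V_1\sqcup V_2$; an elementary cut is an inclusion-minimal nonempty cut; its signing consists of the set of its edges directed from $V_1$ to $V_2$ and the set of its edges directed from $V_2$ to $V_1$ (in either order). $A$ represents the oriented dual of the graphic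 matroid of $G$ if its columns are indexed by $E$ and its signed circuits are exactly the signed elementary cuts of $G$. The root polytope of $A$ is $\mathcal{Q}_A=\mathrm{Conv}\{a_i: i\in E\}$. For $B\subseteq E$ put $\Delta_B=\mathrm{Conv}\{a_i : i\in B\}$. A dissection of a polytope $P$ into simplices is a family of simplices of dimension $\dim P$ whose union is $P$ and which are interior disjoint (the relative interiors of any two members of the family with different indices are disjoint). A triangulation is a dissection into simplices in which, in addition, any two simplices intersect in a common (possibly empty) face. *)

theory Defs
  imports
    "HOL-Analysis.Analysis"
    "Jordan_Normal_Form.Determinant"
    "Graph_Theory.Graph_Theory"
begin

section \<open>Digraphs\<close>

text \<open>The digraphs of \<^locale>\<open>fin_digraph\<close> are finite multigraphs; loops are allowed.\<close>

definition eulerian_digraph :: "('v, 'e) pre_digraph \<Rightarrow> bool" where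
  "eulerian_digraph G \<longleftrightarrow>
     fin_digraph G \<and> arcs G \<noteq> {} \<and> Digraph_Component.connected G \<and>
     (\<forall>v \<in> verts G. in_degree G v = out_degree G v)"

text \<open>The predicates \<^const>\<open>forest\<close> and \<^const>\<open>tree\<close> of Graph_Theory only exclude directed cycles,
  so cycles of the underlying undirected multigraph are defined here: every edge \<open>e\<close> may be
  traversed forwards, \<open>(e, True)\<close>, or backwards, \<open>(e, False)\<close>, but no edge twice. Loops and
  pairs of parallel edges are cycles.\<close>

definition bidirect :: "('v, 'e) pre_digraph \<Rightarrow> ('v, 'e \<times> bool) pre_digraph" where
  "bidirect G =
     \<lparr>verts = verts G, arcs = arcs G \<times> UNIV,
      tail = (\<lambda>(e, fwd). if fwd then tail G e else head G e),
      head = (\<lambda>(e, fwd). if fwd then head G e else tail G e)\<rparr>"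

definition undirected_cycle :: "('v, 'e) pre_digraph \<Rightarrow> ('e \<times> bool) list \<Rightarrow> bool" where
  "undirected_cycle G p \<longleftrightarrow> pre_digraph.cycle (bidirect G) p \<and> distinct (map fst p)"

definition undirected_tree :: "('v, 'e) pre_digraph \<Rightarrow> bool" where
  "undirected_tree F \<longleftrightarrow> Digraph_Component.connected F \<and> (\<nexists>p. undirected_cycle F p)"

definition component_of_vertex :: "('v, 'e) pre_digraph \<Rightarrow> 'v \<Rightarrow> 'v set" where
  "component_of_vertex F v = {w. v \<rightarrow>\<^sup>*\<^bsub>with_proj (mk_symmetric F)\<^esub> w}"

definition arborescence :: "('v, 'e) pre_digraph \<Rightarrow> 'v \<Rightarrow> bool" where
  "arborescence F v0 \<longleftrightarrow>
     undirected_tree F \<and> v0 \<in> verts F \<and>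
     (\<forall>e \<in> arcs F. tail F e \<in> component_of_vertex (pre_digraph.del_arc F e) v0)"

definition spanning_arborescence :: "('v, 'e) pre_digraph \<Rightarrow> 'v \<Rightarrow> 'e set \<Rightarrow> bool" where
  "spanning_arborescence G v0 T \<longleftrightarrow>
     (let F = G\<lparr>arcs := T\<rparr> in spanning F G \<and> arborescence F v0)"

definition edges_from_to :: "('v, 'e) pre_digraph \<Rightarrow> 'v set \<Rightarrow> 'v set \<Rightarrow> 'e set" where
  "edges_from_to G V1 V2 = {e \<in> arcs G. tail G e \<in> V1 \<and> head G e \<in> V2}"

definition vertex_bipartition :: "('v, 'e) pre_digraph \<Rightarrow> 'v set \<Rightarrow> 'v set \<Rightarrow> bool" where
  "vertex_bipartition G V1 V2 \<longleftrightarrow> V1 \<union> V2 = verts G \<and> V1 \<inter> V2 = {}"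

definition is_cut :: "('v, 'e) pre_digraph \<Rightarrow> 'e set \<Rightarrow> bool" where
  "is_cut G C \<longleftrightarrow>
     (\<exists>V1 V2. vertex_bipartition G V1 V2 \<and> C = edges_from_to G V1 V2 \<union> edges_from_to G V2 V1)"

definition elementary_cut :: "('v, 'e) pre_digraph \<Rightarrow> 'e set \<Rightarrow> bool" where
  "elementary_cut G C \<longleftrightarrow> is_cut G C \<and> C \<noteq> {} \<and> (\<forall>C'. is_cut G C' \<and> C' \<noteq> {} \<and> C' \<subseteq> C \<longrightarrow> C' = C)"

text \<open>Exchanging \<open>V1\<close> and \<open>V2\<close> gives the opposite signing, so both orders are included.\<close>

definition signed_elementary_cut :: "('v, 'e) pre_digraph \<Rightarrow> 'e set \<Rightarrow> 'e set \<Rightarrow> bool" where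
  "signed_elementary_cut G Cp Cm \<longleftrightarrow>
     (\<exists>V1 V2. vertex_bipartition G V1 V2 \<and>
        Cp = edges_from_to G V1 V2 \<and> Cm = edges_from_to G V2 V1 \<and> elementary_cut G (Cp \<union> Cm))"


section \<open>Matrices\<close>

text \<open>A matrix with columns indexed by a finite set \<open>E\<close> is given by its columns
  \<open>a e\<close> for \<open>e \<in> E\<close>; the values of \<open>a\<close> outside \<open>E\<close> are irrelevant.
  The entries of a totally unimodular matrix are its subdeterminants of order 1, hence integers.
  The order \<open>k\<close> of a subdeterminant varies, so \<open>det\<close> is the one for matrices with carriers
  from Jordan_Normal_Form, not the type-indexed one.\<close>

definition totally_unimodular :: "'e set \<Rightarrow> ('e \<Rightarrow> real ^ 'n) \<Rightarrow> bool" where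
  "totally_unimodular E a \<longleftrightarrow>
     (\<forall>k (r :: nat \<Rightarrow> 'n) (c :: nat \<Rightarrow> 'e).
        inj_on r {..<k} \<and> inj_on c {..<k} \<and> c ` {..<k} \<subseteq> E \<longrightarrow>
        Determinant.det (Matrix.mat k k (\<lambda>(i, j). vec_nth (a (c j)) (r i))) \<in> {0, 1, -1})"

text \<open>Linear dependence of \<open>(a i)\<close> for \<open>i \<in> C\<close> as a family: unlike with \<open>dependent (a ` C)\<close>,
  a repeated column makes \<open>C\<close> dependent.\<close>

definition dependent_family :: "('e \<Rightarrow> real ^ 'n) \<Rightarrow> 'e set \<Rightarrow> bool" where
  "dependent_family a C \<longleftrightarrow> (\<exists>l. (\<exists>i \<in> C. l i \<noteq> 0) \<and> (\<Sum>i\<in>C. l i *\<^sub>R a i) = 0)"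

definition circuit :: "'e set \<Rightarrow> ('e \<Rightarrow> real ^ 'n) \<Rightarrow> 'e set \<Rightarrow> bool" where
  "circuit E a C \<longleftrightarrow> C \<subseteq> E \<and> dependent_family a C \<and> (\<forall>C'. C' \<subset> C \<longrightarrow> \<not> dependent_family a C')"

definition signed_circuit :: "'e set \<Rightarrow> ('e \<Rightarrow> real ^ 'n) \<Rightarrow> 'e set \<Rightarrow> 'e set \<Rightarrow> bool" where
  "signed_circuit E a Cp Cm \<longleftrightarrow>
     Cp \<inter> Cm = {} \<and> circuit E a (Cp \<union> Cm) \<and>
     (\<exists>l. (\<Sum>i\<in>Cp \<union> Cm. l i *\<^sub>R a i) = 0 \<and> (\<forall>i\<in>Cp. l i > 0) \<and> (\<forall>i\<in>Cm. l i < 0))"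

definition represents_oriented_dual :: "('v, 'e) pre_digraph \<Rightarrow> ('e \<Rightarrow> real ^ 'n) \<Rightarrow> bool" where
  "represents_oriented_dual G a \<longleftrightarrow>
     (\<forall>Cp Cm. signed_circuit (arcs G) a Cp Cm \<longleftrightarrow> signed_elementary_cut G Cp Cm)"


section \<open>Polytopes\<close>

definition Delta :: "('e \<Rightarrow> real ^ 'n) \<Rightarrow> 'e set \<Rightarrow> (real ^ 'n) set" where
  "Delta a B = convex hull (a ` B)"

definition root_polytope :: "'e set \<Rightarrow> ('e \<Rightarrow> real ^ 'n) \<Rightarrow> (real ^ 'n) set" where
  "root_polytope E a = convex hull (a ` E)"

text \<open>Families \<open>S\<close> indexed by \<open>I\<close>: members with different indices have disjoint relative
  interiors.\<close>

definition dissection_into_simplices ::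
    "'a::euclidean_space set \<Rightarrow> 'i set \<Rightarrow> ('i \<Rightarrow> 'a set) \<Rightarrow> bool" where
  "dissection_into_simplices P I S \<longleftrightarrow>
     (\<forall>i\<in>I. aff_dim P simplex S i) \<and> (\<Union>i\<in>I. S i) = P \<and>
     (\<forall>i\<in>I. \<forall>j\<in>I. i \<noteq> j \<longrightarrow> rel_interior (S i) \<inter> rel_interior (S j) = {})"

text \<open>The condition on common faces (the empty set is a face) is part of \<^const>\<open>triangulation\<close>.\<close>

definition triangulation_of ::
    "'a::euclidean_space set \<Rightarrow> 'i set \<Rightarrow> ('i \<Rightarrow> 'a set) \<Rightarrow> bool" where
  "triangulation_of P I S \<longleftrightarrow> dissection_into_simplices P I S \<and> triangulation (S ` I)"

end

theory Submission
  imports Defs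
begin

text \<open>
  A vector \<open>x\<close> of edge weights represents the point \<open>\<Sum>e. x e *\<^sub>R a e\<close>. The signed circuits of
  \<open>a\<close> are the signed elementary cuts of \<open>G\<close>, and total unimodularity forces the coefficients of
  each circuit relation to have equal modulus. Hence the linear relations among the columns are
  exactly the potential differences \<open>\<delta>f e = f (head e) - f (tail e)\<close> of functions \<open>f\<close> on the
  vertices (\<open>relation_coboundary\<close>, \<open>coboundary_if_relation\<close>): two weight vectors represent the
  same point if and only if they differ by some \<open>\<delta>f\<close>. Since \<open>G\<close> is Eulerian, every \<open>\<delta>f\<close> sums to
  zero, so this change of weights preserves the total weight.

  Covering: read \<open>x \<ge> 0\<close> as edge lengths and let \<open>f v\<close> be the distance from \<open>v0\<close> to \<open>v\<close>. Then
  \<open>x - \<delta>f \<ge> 0\<close>, and it vanishes on a shortest path arborescence, so the point lies in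
  \<open>\<Delta>\<^sub>B\<close> for the complement \<open>B\<close> of that arborescence. Distances are finite because a connected
  Eulerian digraph is strongly connected.

  Uniqueness: let \<open>x\<close> and \<open>x'\<close> be nonnegative, represent the same point, and vanish on the
  spanning arborescences \<open>T\<close> and \<open>T'\<close>, respectively. Then \<open>x - x' = \<delta>f\<close>, where
  \<open>\<delta>f = - x' \<le> 0\<close> on \<open>T\<close> and \<open>\<delta>f = x \<ge> 0\<close> on \<open>T'\<close>. Along the directed paths from \<open>v0\<close> in the two
  arborescences, \<open>f\<close> is therefore at most and at least \<open>f v0\<close>; it is constant, and \<open>x = x'\<close>.

  So every point of the root polytope has the same weights in all simplices that contain it. This
  gives affine independence of the vertices of each simplex, disjointness of relative interiors,
  and \<open>\<Delta>\<^sub>B \<inter> \<Delta>\<^sub>B\<^sub>' = \<Delta>\<^sub>B\<^sub>\<inter>\<^sub>B\<^sub>'\<close>. The simplices have full dimension because the fundamental cut of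
  an edge \<open>e\<close> of the arborescence expresses \<open>a e\<close> as an affine combination of the vectors in \<open>B\<close>.
\<close>

section \<open>Totally unimodular matrices\<close>

definition minor :: "('e \<Rightarrow> real ^ 'n) \<Rightarrow> (nat \<Rightarrow> 'n) \<Rightarrow> (nat \<Rightarrow> 'e) \<Rightarrow> nat \<Rightarrow> real" where
  "minor a r c k = Determinant.det (Matrix.mat k k (\<lambda>(i, j). vec_nth (a (c j)) (r i)))"

lemma inj_on_rows_if_minor_nonzero:
  assumes "minor a r c k \<noteq> 0"
  shows "inj_on r {..<k}"
proof (rule inj_onI, rule ccontr)
  fix i j
  assume ij: "i \<in> {..<k}" "j \<in> {..<k}" "r i = r j" "i \<noteq> j"
  have "Determinant.det (Matrix.mat k k (\<lambda>(i, j). vec_nth (a (c j)) (r i))) = 0"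
    by (rule Determinant.det_identical_rows[where n = k and i = i and j = j])
      (use ij in \<open>auto intro!: eq_vecI\<close>)
  with assms show False
    by (simp add: minor_def)
qed

text \<open>Border a nonzero minor of order \<open>k\<close> by one more column and by a variable row \<open>s\<close>. Laplace
  expansion along row \<open>s\<close> writes the bordered minor as row \<open>s\<close> of the linear combination of the
  columns by cofactors that do not depend on \<open>s\<close>. If all bordered minors vanish, these
  cofactors are a linear relation; they are subdeterminants up to sign, and the last one is the
  given nonzero minor.\<close>

lemma extend_nonzero_minor:
  fixes a :: "'e \<Rightarrow> real ^ 'n"
  assumes tu: "totally_unimodular E a"
    and c: "inj_on c {..<Suc k}" "c ` {..<Suc k} \<subseteq> E"
    and r: "minor a r c k \<noteq> 0"
  shows "(\<exists>r'. minor a r' c (Suc k) \<noteq> 0) \<or>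
    (\<exists>\<mu>. (\<forall>j. \<mu> j \<in> {0, 1, -1}) \<and> \<mu> k \<noteq> 0 \<and> (\<Sum>j<Suc k. \<mu> j *\<^sub>R a (c j)) = 0)"
proof (rule disjCI)
  assume "\<nexists>\<mu>. (\<forall>j. \<mu> j \<in> {0, 1, -1}) \<and> \<mu> k \<noteq> 0 \<and> (\<Sum>j<Suc k. \<mu> j *\<^sub>R a (c j)) = 0"
  moreover define skip where "skip j = (\<lambda>i. if i < j then i else Suc i)" for j :: nat
  define \<mu> where "\<mu> j = (if j \<le> k then (-1) ^ (k + j) * minor a r (c \<circ> skip j) k else 0)" for j
  \<comment> \<open>\<open>\<mu> j\<close> is the cofactor of column \<open>j\<close> along a last row that may be chosen freely\<close>
  have mu_range: "\<mu> j \<in> {0, 1, -1}" for j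
  proof (cases "j \<le> k")
    case True
    have "inj_on (c \<circ> skip j) {..<k}"
      by (rule comp_inj_on, force simp: skip_def inj_on_def split: if_splits)
        (rule inj_on_subset[OF c(1)], auto simp: skip_def)
    moreover have "(c \<circ> skip j) ` {..<k} \<subseteq> E"
      using c(2) by (auto simp: skip_def)
    ultimately have "minor a r (c \<circ> skip j) k \<in> {0, 1, -1}"
      using tu inj_on_rows_if_minor_nonzero[OF r]
      unfolding totally_unimodular_def minor_def by blast
    then show ?thesis
      by (cases "even (k + j)") (auto simp: \<mu>_def)
  qed (simp add: \<mu>_def)
  have mu_k: "\<mu> k \<noteq> 0"
  proof -
    have "minor a r (c \<circ> skip k) k = minor a r c k"
      unfolding minor_def
      by (rule arg_cong[where f = Determinant.det]) (auto simp: skip_def)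
    then show ?thesis
      using r by (simp add: \<mu>_def)
  qed
  ultimately have "(\<Sum>j<Suc k. \<mu> j *\<^sub>R a (c j)) \<noteq> 0"
    using mu_range by blast
  then obtain s where s: "vec_nth (\<Sum>j<Suc k. \<mu> j *\<^sub>R a (c j)) s \<noteq> 0"
    by (auto simp: Finite_Cartesian_Product.vec_eq_iff)
  define A where "A = Matrix.mat (Suc k) (Suc k) (\<lambda>(i, j). vec_nth (a (c j)) ((r(k := s)) i))"
  have "Determinant.det A = (\<Sum>j<Suc k. A $$ (k, j) * cofactor A k j)"
    by (rule laplace_expansion_row) (auto simp: A_def)
  also have "\<dots> = (\<Sum>j<Suc k. vec_nth (a (c j)) s * \<mu> j)"
  proof (rule sum.cong[OF refl])
    fix j assume j: "j \<in> {..<Suc k}"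
    have "mat_delete A k j = Matrix.mat k k (\<lambda>(i, j'). vec_nth (a ((c \<circ> skip j) j')) (r i))"
      using j by (intro eq_matI) (auto simp: A_def mat_delete_def skip_def)
    then have "cofactor A k j = \<mu> j"
      using j by (simp add: cofactor_def \<mu>_def minor_def)
    then show "A $$ (k, j) * cofactor A k j = vec_nth (a (c j)) s * \<mu> j"
      using j by (simp add: A_def)
  qed
  also have "\<dots> \<noteq> 0"
    using s by (simp add: mult.commute)
  finally show "\<exists>r'. minor a r' c (Suc k) \<noteq> 0"
    unfolding minor_def A_def by blast
qed

lemma minor_zero_if_dependent:
  fixes a :: "'e \<Rightarrow> real ^ 'n"
  assumes "(\<Sum>j<k. l j *\<^sub>R a (c j)) = 0" "j < k" "l j \<noteq> 0"
  shows "minor a r c k = 0"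
proof -
  define A where "A = Matrix.mat k k (\<lambda>(i, j). vec_nth (a (c j)) (r i))"
  have A: "A \<in> carrier_mat k k"
    by (simp add: A_def)
  have "Matrix.vec k l \<noteq> 0\<^sub>v k"
  proof
    assume "Matrix.vec k l = 0\<^sub>v k"
    then have "vec_index (Matrix.vec k l) j = vec_index (0\<^sub>v k) j"
      by (rule arg_cong)
    then show False
      using assms(2,3) by simp
  qed
  moreover have "A *\<^sub>v Matrix.vec k l = 0\<^sub>v k"
  proof (rule eq_vecI)
    fix i assume "i < dim_vec (0\<^sub>v k :: real Matrix.vec)"
    then have i: "i < k" by simp
    have "vec_index (A *\<^sub>v Matrix.vec k l) i = (\<Sum>j<k. vec_nth (a (c j)) (r i) * l j)"
      using i by (simp add: A_def scalar_prod_def lessThan_atLeast0)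
    also have "\<dots> = vec_nth (\<Sum>j<k. l j *\<^sub>R a (c j)) (r i)"
      by (simp add: mult.commute)
    finally show "vec_index (A *\<^sub>v Matrix.vec k l) i = vec_index (0\<^sub>v k) i"
      using assms(1) i by simp
  qed (simp add: A_def)
  ultimately have "Determinant.det A = 0"
    unfolding det_0_iff_vec_prod_zero[OF A] by (intro exI[of _ "Matrix.vec k l"]) auto
  then show ?thesis
    by (simp add: minor_def A_def)
qed

text \<open>Add the columns of \<open>C\<close> one by one, enlarging a nonzero minor. This must fail at some
  column, because the full minors of dependent columns are zero, and where it fails
  \<open>extend_nonzero_minor\<close> supplies the relation.\<close>

lemma unimodular_dependency:
  fixes a :: "'e \<Rightarrow> real ^ 'n"
  assumes tu: "totally_unimodular E a"
    and C: "C \<subseteq> E" "finite C" "dependent_family a C"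
  obtains \<mu> where "\<And>i. i \<in> C \<Longrightarrow> \<mu> i \<in> {0, 1, -1}" "\<exists>i\<in>C. \<mu> i \<noteq> 0" "(\<Sum>i\<in>C. \<mu> i *\<^sub>R a i) = 0"
proof -
  define m where "m = card C"
  obtain c where c: "bij_betw c {..<m} C"
    using C(2) unfolding m_def by (metis bij_betw_from_nat_into_finite)
  then have c_inj: "inj_on c {..<m}" and c_im: "c ` {..<m} = C"
    by (auto simp: bij_betw_def)
  let ?dep = "\<exists>\<nu>. (\<forall>j. \<nu> j \<in> {0, 1, -1}) \<and> (\<exists>j<m. \<nu> j \<noteq> 0) \<and> (\<Sum>j<m. \<nu> j *\<^sub>R a (c j)) = 0"
  have "?dep \<or> (\<exists>r. minor a r c k \<noteq> 0)" if "k \<le> m" for k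
    using that
  proof (induction k)
    case 0
    then show ?case by (simp add: minor_def)
  next
    case (Suc k)
    show ?case
    proof (cases ?dep)
      case False
      with Suc obtain r where r: "minor a r c k \<noteq> 0" by auto
      have "(\<exists>r'. minor a r' c (Suc k) \<noteq> 0) \<or>
        (\<exists>\<mu>. (\<forall>j. \<mu> j \<in> {0, 1, -1}) \<and> \<mu> k \<noteq> 0 \<and> (\<Sum>j<Suc k. \<mu> j *\<^sub>R a (c j)) = 0)"
        by (rule extend_nonzero_minor[OF tu _ _ r])
          (use Suc.prems c_inj c_im C(1) in \<open>auto intro: inj_on_subset\<close>)
      moreover have ?dep if "\<forall>j. \<mu> j \<in> {0, 1, -1}" "\<mu> k \<noteq> 0" "(\<Sum>j<Suc k. \<mu> j *\<^sub>R a (c j)) = 0" for \<mu>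
      proof (intro exI conjI)
        let ?\<nu> = "\<lambda>j. if j < Suc k then \<mu> j else 0"
        show "\<forall>j. ?\<nu> j \<in> {0, 1, -1}" using that(1) by simp
        show "k < m" "?\<nu> k \<noteq> 0" using that(2) Suc.prems by auto
        have "(\<Sum>j<m. ?\<nu> j *\<^sub>R a (c j)) = (\<Sum>j<Suc k. ?\<nu> j *\<^sub>R a (c j))"
          by (rule sum.mono_neutral_right) (use Suc.prems in auto)
        then show "(\<Sum>j<m. ?\<nu> j *\<^sub>R a (c j)) = 0"
          using that(3) by simp
      qed
      ultimately show ?thesis using False by blast
    qed blast
  qed
  moreover have "minor a r c m = 0" for r
  proof -
    obtain l where l: "\<exists>i\<in>C. l i \<noteq> 0" "(\<Sum>i\<in>C. l i *\<^sub>R a i) = 0"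
      using C(3) by (auto simp: dependent_family_def)
    have "(\<Sum>j<m. (l \<circ> c) j *\<^sub>R a (c j)) = 0"
      using l(2) sum.reindex_bij_betw[OF c, of "\<lambda>i. l i *\<^sub>R a i"] by simp
    moreover obtain j where "j < m" "(l \<circ> c) j \<noteq> 0"
      using l(1) c_im by auto
    ultimately show ?thesis
      by (rule minor_zero_if_dependent)
  qed
  ultimately obtain \<nu> where \<nu>: "\<forall>j. \<nu> j \<in> {0, 1, -1 :: real}" "\<exists>j<m. \<nu> j \<noteq> 0"
      "(\<Sum>j<m. \<nu> j *\<^sub>R a (c j)) = 0"
    by blast
  define \<mu> where "\<mu> = \<nu> \<circ> the_inv_into {..<m} c"
  have \<mu>: "\<mu> (c j) = \<nu> j" if "j < m" for j
    using that c_inj by (simp add: \<mu>_def the_inv_into_f_f)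
  show thesis
  proof (rule that)
    show "\<mu> i \<in> {0, 1, -1}" if "i \<in> C" for i
      using \<nu>(1) by (simp add: \<mu>_def)
    show "\<exists>i\<in>C. \<mu> i \<noteq> 0"
      using \<nu>(2) \<mu> c_im by (metis imageI lessThan_iff)
    show "(\<Sum>i\<in>C. \<mu> i *\<^sub>R a i) = 0"
      using \<nu>(3) sum.reindex_bij_betw[OF c, of "\<lambda>i. \<mu> i *\<^sub>R a i"] \<mu> by simp
  qed
qed

text \<open>By minimality of a circuit, its relations form a line, and a nonzero relation has no zero
  coordinate.\<close>

lemma circuit_dependency_vanishes:
  assumes C: "circuit E a C" "finite C"
    and m: "(\<Sum>i\<in>C. m i *\<^sub>R a i) = 0" and k: "k \<in> C" "m k = 0"
  shows "\<forall>i\<in>C. m i = 0"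
proof (rule ccontr)
  assume "\<not> (\<forall>i\<in>C. m i = 0)"
  moreover have "(\<Sum>i\<in>C - {k}. m i *\<^sub>R a i) = 0"
    using m k C(2) by (simp add: sum.remove)
  ultimately have "dependent_family a (C - {k})"
    using k unfolding dependent_family_def by (intro exI[of _ m]) auto
  then show False
    using C(1) k(1) unfolding circuit_def by blast
qed

text \<open>All relations of a circuit are proportional to one with coefficients \<open>1\<close> and \<open>-1\<close>. This is where
  total unimodularity enters: the signs of a relation of a circuit determine it up to a factor.\<close>

lemma circuit_dependency_constant_modulus:
  fixes a :: "'e \<Rightarrow> real ^ 'n"
  assumes tu: "totally_unimodular E a" and fin: "finite E"
    and C: "circuit E a C"
    and l: "(\<Sum>i\<in>C. l i *\<^sub>R a i) = 0"
    and ij: "i \<in> C" "j \<in> C"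
  shows "\<bar>l i\<bar> = \<bar>l j\<bar>"
proof -
  have CE: "C \<subseteq> E" and finC: "finite C" and dep: "dependent_family a C"
    using C fin by (auto simp: circuit_def intro: finite_subset)
  note minimal = circuit_dependency_vanishes[OF C finC]
  obtain \<mu> where \<mu>: "\<And>i. i \<in> C \<Longrightarrow> \<mu> i \<in> {0, 1, -1}" "\<exists>i\<in>C. \<mu> i \<noteq> 0" "(\<Sum>i\<in>C. \<mu> i *\<^sub>R a i) = 0"
    using unimodular_dependency[OF tu CE finC dep] by blast
  have mu_abs: "\<bar>\<mu> i\<bar> = 1" if "i \<in> C" for i
    using minimal[OF \<mu>(3) that] \<mu>(1)[OF that] \<mu>(2) by auto
  define t where "t = l i / \<mu> i"
  have "(\<Sum>i\<in>C. (l i - t * \<mu> i) *\<^sub>R a i) = 0"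
    using l \<mu>(3) by (simp add: scaleR_left_diff_distrib sum_subtractf flip: scaleR_scaleR scaleR_sum_right)
  moreover have "l i - t * \<mu> i = 0"
    using mu_abs[OF ij(1)] by (auto simp: t_def)
  ultimately have "\<forall>j\<in>C. l j - t * \<mu> j = 0"
    by (rule minimal[OF _ ij(1)])
  then have "l j = t * \<mu> j" if "j \<in> C" for j
    using that by (simp only: right_minus_eq)
  then show ?thesis
    using mu_abs ij by (metis abs_mult)
qed

section \<open>Spanning arborescences\<close>

text \<open>Reachability by a set \<open>T\<close> of edges rather than in a digraph, so that edges can be removed without
  changing the digraph.\<close>

definition reach :: "('v, 'e) pre_digraph \<Rightarrow> 'e set \<Rightarrow> 'v \<Rightarrow> 'v set" where
  "reach G T v = {w. (v, w) \<in> {(tail G e, head G e) | e. e \<in> T}\<^sup>*}"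

lemma reach_refl: "v \<in> reach G T v"
  by (simp add: reach_def)

lemma reach_step:
  assumes "e \<in> T" "tail G e \<in> reach G T v"
  shows "head G e \<in> reach G T v"
  using assms unfolding reach_def by (auto intro: rtrancl_into_rtrancl)

lemma reach_least:
  assumes "v \<in> S" and step: "\<And>e. e \<in> T \<Longrightarrow> tail G e \<in> S \<Longrightarrow> head G e \<in> S"
  shows "reach G T v \<subseteq> S"
proof
  fix w assume "w \<in> reach G T v"
  then have "(v, w) \<in> {(tail G e, head G e) | e. e \<in> T}\<^sup>*"
    by (simp add: reach_def)
  then show "w \<in> S"
    by induction (use assms in auto)
qed

lemma reach_mono:
  assumes "T \<subseteq> T'"
  shows "reach G T v \<subseteq> reach G T' v"
  by (rule reach_least) (use assms in \<open>auto intro: reach_refl reach_step\<close>)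

lemma bidirect_simps [simp]:
  "verts (bidirect F) = verts F"
  "arcs (bidirect F) = arcs F \<times> UNIV"
  "tail (bidirect F) (e, d) = (if d then tail F e else head F e)"
  "head (bidirect F) (e, d) = (if d then head F e else tail F e)"
  by (simp_all add: bidirect_def)

lemma arcs_ends_bidirect:
  "arcs_ends (bidirect F) = {(tail F e, head F e) | e. e \<in> arcs F} \<union> {(head F e, tail F e) | e. e \<in> arcs F}"
  (is "?L = ?R")
proof
  show "?L \<subseteq> ?R" by (auto simp: arcs_ends_conv)
  have "(tail F e, head F e) \<in> ?L" if "e \<in> arcs F" for e
    unfolding arcs_ends_conv by (rule image_eqI[of _ _ "(e, True)"]) (use that in auto)
  moreover have "(head F e, tail F e) \<in> ?L" if "e \<in> arcs F" for e
    unfolding arcs_ends_conv by (rule image_eqI[of _ _ "(e, False)"]) (use that in auto)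
  ultimately show "?R \<subseteq> ?L" by blast
qed

text \<open>Connectedness and components refer to the symmetric closure of the edge relation, cycles to the
  bidirected digraph, in which walks remember their edges. Both have the same reachability.\<close>

lemma reachable_mk_symmetric_iff_bidirect:
  "u \<rightarrow>\<^sup>*\<^bsub>with_proj (mk_symmetric F)\<^esub> w \<longleftrightarrow> u \<rightarrow>\<^sup>*\<^bsub>bidirect F\<^esub> w"
proof -
  have "arcs_ends (bidirect F) = arcs_ends (with_proj (mk_symmetric F))"
    unfolding arcs_ends_bidirect by (auto simp: mk_symmetric_def)
  then show ?thesis
    by (simp add: reachable_def)
qed

lemma wf_digraph_bidirect:
  assumes "wf_digraph F"
  shows "wf_digraph (bidirect F)"
proof -
  interpret wf_digraph F by fact
  show ?thesis
    by unfold_locales auto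
qed

lemma reachable_bidirect_sym:
  assumes "u \<rightarrow>\<^sup>*\<^bsub>bidirect F\<^esub> w"
  shows "w \<rightarrow>\<^sup>*\<^bsub>bidirect F\<^esub> u"
proof (rule symmetric_reachable[OF _ assms])
  show "symmetric (bidirect F)"
    unfolding symmetric_def arcs_ends_bidirect by (auto intro!: symI)
qed

lemma component_of_vertex_iff:
  "w \<in> component_of_vertex F v \<longleftrightarrow> v \<rightarrow>\<^sup>*\<^bsub>bidirect F\<^esub> w"
  by (simp add: component_of_vertex_def reachable_mk_symmetric_iff_bidirect)

lemma component_of_vertex_refl:
  assumes "wf_digraph F" "v \<in> verts F"
  shows "v \<in> component_of_vertex F v"
  using wf_digraph.reachable_refl[OF wf_digraph_bidirect[OF assms(1)]] assms(2)
  by (simp add: component_of_vertex_iff)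

lemma tail_in_component_iff_head:
  assumes "wf_digraph F" "e \<in> arcs F"
  shows "tail F e \<in> component_of_vertex F v \<longleftrightarrow> head F e \<in> component_of_vertex F v"
proof -
  interpret B: wf_digraph "bidirect F" using assms(1) by (rule wf_digraph_bidirect)
  have "tail F e \<rightarrow>\<^bsub>bidirect F\<^esub> head F e" "head F e \<rightarrow>\<^bsub>bidirect F\<^esub> tail F e"
    using assms(2) unfolding arcs_ends_bidirect by blast+
  then show ?thesis
    unfolding component_of_vertex_iff by (meson B.reachable_adj_trans)
qed

lemma verts_subset_if_closed:
  assumes conn: "Digraph_Component.connected F"
    and u: "u \<in> verts F" "u \<in> S"
    and closed: "\<And>e. e \<in> arcs F \<Longrightarrow> tail F e \<in> S \<longleftrightarrow> head F e \<in> S"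
  shows "verts F \<subseteq> S"
proof
  fix w assume "w \<in> verts F"
  with conn u(1) have "u \<rightarrow>\<^sup>*\<^bsub>bidirect F\<^esub> w"
    unfolding Digraph_Component.connected_def
    by (auto simp: strongly_connected_def reachable_mk_symmetric_iff_bidirect)
  then have "(u, w) \<in> (arcs_ends (bidirect F))\<^sup>*"
    by (rule reachable_rtranclI)
  then show "w \<in> S"
    by induction (use u closed in \<open>auto simp: arcs_ends_bidirect\<close>)
qed

text \<open>Using an edge a second time, in either direction, would revisit one of its ends.\<close>

lemma apath_bidirect_no_repeated_edge:
  assumes "wf_digraph F" "pre_digraph.apath (bidirect F) u p w"
  shows "distinct (map fst p)"
  using assms(2)
proof (induction p arbitrary: u)
  case (Cons x p)
  interpret B: wf_digraph "bidirect F" using assms(1) by (rule wf_digraph_bidirect)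
  obtain e d where x: "x = (e, d)" by (cases x)
  have walk: "B.apath (head (bidirect F) x) p w"
    and fresh: "tail (bidirect F) x \<notin> set (B.awalk_verts (head (bidirect F) x) p)"
    using Cons.prems by (auto simp: B.apath_Cons_iff)
  have "e \<notin> fst ` set p"
  proof
    assume "e \<in> fst ` set p"
    then obtain d' where "(e, d') \<in> set p" by auto
    then have "tail (bidirect F) (e, d') \<in> set (B.awalk_verts (head (bidirect F) x) p)"
        "head (bidirect F) (e, d') \<in> set (B.awalk_verts (head (bidirect F) x) p)"
      using walk by (auto simp: B.apath_def intro: B.awalk_verts_arc1 B.awalk_verts_arc2 simp del: bidirect_simps)
    then show False
      using fresh by (cases d; cases d') (auto simp: x)
  qed
  then show ?case
    using Cons.IH[OF walk] by (simp add: x)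
qed simp

text \<open>Otherwise a path from the head of \<open>e\<close> back to its tail avoids \<open>e\<close> and closes up with \<open>e\<close> to an
  undirected cycle.\<close>

lemma head_not_in_component_without_edge:
  assumes wf: "wf_digraph F" and acyclic: "\<nexists>p. undirected_cycle F p"
    and e: "e \<in> arcs F" "tail F e \<in> component_of_vertex (pre_digraph.del_arc F e) v"
  shows "head F e \<notin> component_of_vertex (pre_digraph.del_arc F e) v"
proof
  let ?F' = "pre_digraph.del_arc F e"
  assume head: "head F e \<in> component_of_vertex ?F' v"
  have wf': "wf_digraph ?F'"
    using wf by (simp add: wf_digraph_def pre_digraph.del_arc_simps)
  interpret B': wf_digraph "bidirect ?F'" using wf' by (rule wf_digraph_bidirect)
  interpret B: wf_digraph "bidirect F" using wf by (rule wf_digraph_bidirect)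
  have "head F e \<rightarrow>\<^sup>*\<^bsub>bidirect ?F'\<^esub> tail F e"
    using head e(2) unfolding component_of_vertex_iff
    by (blast intro: B'.reachable_trans reachable_bidirect_sym)
  then obtain p where p: "B'.apath (head F e) p (tail F e)"
    by (auto simp: B'.reachable_apath)
  have sub: "subgraph (bidirect ?F') (bidirect F)"
    by (rule subgraphI)
      (auto simp: pre_digraph.del_arc_simps compatible_def bidirect_def B.wf_digraph B'.wf_digraph
        simp flip: bidirect_def)
  have p_F: "B.apath (head F e) p (tail F e)"
    using B.subgraph_apath_imp_apath[OF p sub] .
  have "B.awalk (tail F e) ((e, True) # p) (tail F e)"
    using p_F e(1) by (auto simp: B.awalk_Cons_iff B.apath_def)
  moreover have "distinct (tl (B.awalk_verts (tail F e) ((e, True) # p)))"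
    using p_F by (simp add: B.apath_def)
  ultimately have "B.cycle ((e, True) # p)"
    unfolding B.cycle_def by blast
  moreover have "e \<notin> fst ` set p"
    using p by (auto simp: B'.apath_def B'.awalk_def pre_digraph.del_arc_simps)
  ultimately have "undirected_cycle F ((e, True) # p)"
    using apath_bidirect_no_repeated_edge[OF wf p_F] by (simp add: undirected_cycle_def)
  with acyclic show False by blast
qed

text \<open>The fundamental cut of \<open>e\<close>: it meets the arborescence in \<open>e\<close> only, and \<open>e\<close> points away from
  the root.\<close>

lemma spanning_arborescence_fundamental_cut:
  assumes T: "spanning_arborescence G v0 T" and e: "e \<in> T"
  obtains S where "v0 \<in> S" "tail G e \<in> S" "head G e \<notin> S"
    "\<And>e'. e' \<in> T - {e} \<Longrightarrow> tail G e' \<in> S \<longleftrightarrow> head G e' \<in> S"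
proof -
  let ?F = "G\<lparr>arcs := T\<rparr>"
  have wf: "wf_digraph ?F" and v0: "v0 \<in> verts ?F" and acyclic: "\<nexists>p. undirected_cycle ?F p"
    and tail: "tail ?F e \<in> component_of_vertex (pre_digraph.del_arc ?F e) v0"
    using T e by (auto simp: spanning_arborescence_def Let_def spanning_def arborescence_def undirected_tree_def)
  have wf': "wf_digraph (pre_digraph.del_arc ?F e)"
    using wf by (simp add: wf_digraph_def pre_digraph.del_arc_simps)
  show thesis
  proof (rule that[of "component_of_vertex (pre_digraph.del_arc ?F e) v0"])
    show "v0 \<in> component_of_vertex (pre_digraph.del_arc ?F e) v0"
      by (rule component_of_vertex_refl[OF wf']) (use v0 in \<open>simp add: pre_digraph.del_arc_simps\<close>)
    show "tail G e \<in> component_of_vertex (pre_digraph.del_arc ?F e) v0"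
      using tail by simp
    show "head G e \<notin> component_of_vertex (pre_digraph.del_arc ?F e) v0"
      using head_not_in_component_without_edge[OF wf acyclic _ tail] e by simp
    show "tail G e' \<in> component_of_vertex (pre_digraph.del_arc ?F e) v0 \<longleftrightarrow>
        head G e' \<in> component_of_vertex (pre_digraph.del_arc ?F e) v0" if "e' \<in> T - {e}" for e'
      using tail_in_component_iff_head[OF wf', of e'] that by (simp add: pre_digraph.del_arc_simps)
  qed
qed

text \<open>If an edge of \<open>T\<close> entered the set of vertices reachable from \<open>v0\<close>, its head would be reachable
  without crossing the fundamental cut of that edge. So no edge of \<open>T\<close> enters or leaves this set,
  and \<open>T\<close> is connected.\<close>

lemma spanning_arborescence_reaches_all:
  assumes T: "spanning_arborescence G v0 T"
  shows "verts G \<subseteq> reach G T v0"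
proof -
  let ?F = "G\<lparr>arcs := T\<rparr>"
  have conn: "Digraph_Component.connected ?F" and v0: "v0 \<in> verts ?F"
    using T by (auto simp: spanning_arborescence_def Let_def arborescence_def undirected_tree_def)
  have closed: "tail G e \<in> reach G T v0" if e: "e \<in> T" "head G e \<in> reach G T v0" for e
  proof (rule ccontr)
    assume tail: "tail G e \<notin> reach G T v0"
    obtain S where S: "v0 \<in> S" "tail G e \<in> S" "head G e \<notin> S"
        "\<And>e'. e' \<in> T - {e} \<Longrightarrow> tail G e' \<in> S \<longleftrightarrow> head G e' \<in> S"
      using spanning_arborescence_fundamental_cut[OF T e(1)] by blast
    have "reach G T v0 \<subseteq> reach G T v0 \<inter> S"
    proof (rule reach_least)
      show "head G e' \<in> reach G T v0 \<inter> S" if "e' \<in> T" "tail G e' \<in> reach G T v0 \<inter> S" for e'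
        using that S(4)[of e'] tail by (cases "e' = e") (auto intro: reach_step)
    qed (simp add: S reach_refl)
    then show False using S(3) e(2) by blast
  qed
  have "verts ?F \<subseteq> reach G T v0"
    by (rule verts_subset_if_closed[OF conn v0 reach_refl]) (auto intro: closed reach_step)
  then show ?thesis by simp
qed

text \<open>Minimality makes every vertex the head of at most one edge of \<open>T\<close>, and \<open>v0\<close> the head of none.
  An undirected cycle has as many edges as vertices, so its edges include every edge of \<open>T\<close> that
  enters one of its vertices; the cycle could then not be reached from \<open>v0\<close>.\<close>

lemma spanning_arborescence_if_minimal_reaching:
  assumes fin: "fin_digraph G" and v0: "v0 \<in> verts G" and T: "T \<subseteq> arcs G"
    and reach: "verts G \<subseteq> reach G T v0"
    and minimal: "\<And>e. e \<in> T \<Longrightarrow> \<not> verts G \<subseteq> reach G (T - {e}) v0"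
  shows "spanning_arborescence G v0 T"
proof -
  interpret fin_digraph G by fact
  let ?F = "G\<lparr>arcs := T\<rparr>"
  have wf: "wf_digraph ?F"
    using T by unfold_locales auto
  have wf_del: "wf_digraph (pre_digraph.del_arc ?F e)" for e
    using wf by (simp add: wf_digraph_def pre_digraph.del_arc_simps)
  have all_reached: "verts G \<subseteq> S"
    if "v0 \<in> S" "\<And>e. e \<in> T \<Longrightarrow> tail G e \<in> S \<Longrightarrow> head G e \<in> S" for S
    using reach reach_least[OF that] by blast
  have tail_reached: "tail G e \<in> reach G (T - {e}) v0" if e: "e \<in> T" for e
  proof (rule ccontr)
    assume "tail G e \<notin> reach G (T - {e}) v0"
    then have "verts G \<subseteq> reach G (T - {e}) v0"
      by (intro all_reached reach_refl) (metis DiffI reach_step singletonD)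
    with minimal[OF e] show False by blast
  qed
  have head_not_reached: "head G e \<notin> reach G (T - {e}) v0" if e: "e \<in> T" for e
  proof
    assume "head G e \<in> reach G (T - {e}) v0"
    then have "verts G \<subseteq> reach G (T - {e}) v0"
      by (intro all_reached reach_refl) (metis DiffI reach_step singletonD)
    with minimal[OF e] show False by blast
  qed
  have head_v0: "head G e \<noteq> v0" if "e \<in> T" for e
    using head_not_reached[OF that] reach_refl by metis
  have head_inj: "inj_on (head G) T"
  proof (rule inj_onI, rule ccontr)
    fix e e' assume ee': "e \<in> T" "e' \<in> T" "head G e = head G e'" "e \<noteq> e'"
    \<comment> \<open>a path to one of the tails avoiding both edges would extend to the common head avoiding the other edge\<close>
    let ?R = "reach G (T - {e, e'}) v0"
    have "tail G e' \<notin> ?R"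
      using head_not_reached[OF ee'(1)] ee' reach_step[of e' "T - {e}" G v0]
        reach_mono[of "T - {e, e'}" "T - {e}" G v0] by auto
    moreover have "tail G e \<notin> ?R"
      using head_not_reached[OF ee'(2)] ee' reach_step[of e "T - {e'}" G v0]
        reach_mono[of "T - {e, e'}" "T - {e'}" G v0] by auto
    ultimately have "verts G \<subseteq> ?R"
      by (intro all_reached reach_refl) (metis DiffI insertE reach_step singletonD)
    then show False
      using \<open>tail G e \<notin> ?R\<close> tail_in_verts[of e] ee'(1) T by blast
  qed
  have acyclic: "\<not> undirected_cycle ?F p" for p
  proof
    assume cyc: "undirected_cycle ?F p"
    interpret B: wf_digraph "bidirect ?F" using wf by (rule wf_digraph_bidirect)
    obtain u where walk: "B.awalk u p u" and dist: "distinct (tl (B.awalk_verts u p))"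
      and p: "p \<noteq> []" "distinct (map fst p)"
      using cyc by (auto simp: undirected_cycle_def B.cycle_def)
    define W where "W = set (tl (B.awalk_verts u p))"
    have len: "length (tl (B.awalk_verts u p)) = length p"
      by (simp add: B.length_awalk_verts)
    have tl_verts: "tl (B.awalk_verts u p) \<noteq> []"
      using p(1) len by (metis length_0_conv)
    have "u = last (B.awalk_verts u p)"
      using walk by (simp add: B.awlast_of_awalk[OF walk] B.awalk_ends)
    also have "\<dots> = last (tl (B.awalk_verts u p))"
      using tl_verts by (simp add: last_tl)
    also have "\<dots> \<in> W"
      unfolding W_def using tl_verts by (rule last_in_set)
    finally have u: "u \<in> W" .
    have W: "W = set (B.awalk_verts u p)"
    proof -
      have "B.awalk_verts u p = u # tl (B.awalk_verts u p)"
        using B.awhd_of_awalk[OF walk] by (metis B.awalk_verts_non_Nil list.collapse)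
      then show ?thesis using u unfolding W_def by (metis insert_absorb list.simps(15))
    qed
    have pT: "fst ` set p \<subseteq> T"
      using walk by (auto simp: B.awalk_def)
    have ends: "tail G e \<in> W \<and> head G e \<in> W" if e: "e \<in> fst ` set p" for e
    proof -
      obtain d where d: "(e, d) \<in> set p" using e by auto
      have "tail (bidirect ?F) (e, d) \<in> W" "head (bidirect ?F) (e, d) \<in> W"
        unfolding W using B.awalk_verts_arc1[OF d] B.awalk_verts_arc2[OF walk d] by blast+
      then show ?thesis by (cases d) auto
    qed
    \<comment> \<open>the heads of the cycle edges are distinct vertices of the cycle, hence all of them\<close>
    have "card (head G ` fst ` set p) = card (fst ` set p)"
      by (rule card_image) (rule inj_on_subset[OF head_inj pT])
    also have "\<dots> = card (set (map fst p))" by simp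
    also have "\<dots> = length p"
      using distinct_card[OF p(2)] by simp
    also have "\<dots> = card W"
      unfolding W_def using distinct_card[OF dist] len by simp
    finally have heads: "head G ` fst ` set p = W"
      by (intro card_subset_eq) (use ends in \<open>auto simp: W_def\<close>)
    have "verts G \<subseteq> - W"
    proof (rule all_reached)
      show "v0 \<in> - W"
        using heads head_v0 pT by auto
      show "head G e \<in> - W" if e: "e \<in> T" "tail G e \<in> - W" for e
      proof
        assume "head G e \<in> W"
        then obtain e' where "e' \<in> fst ` set p" "head G e = head G e'"
          using heads by auto
        then have "e \<in> fst ` set p"
          using head_inj pT e(1) by (metis inj_onD subsetD)
        then show False using ends e(2) by auto
      qed
    qed
    moreover have "u \<in> verts G"
      using walk by (simp add: B.awalk_def)
    ultimately show False using u by blast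
  qed
  have component: "reach G T' v0 \<subseteq> component_of_vertex F v0"
    if "wf_digraph F" "arcs F = T'" "verts F = verts G" "tail F = tail G" "head F = head G" for F T'
  proof (rule reach_least)
    show "v0 \<in> component_of_vertex F v0"
      by (rule component_of_vertex_refl) (use that v0 in auto)
    show "head G e \<in> component_of_vertex F v0" if "e \<in> T'" "tail G e \<in> component_of_vertex F v0" for e
      using tail_in_component_iff_head[of F e v0] that \<open>wf_digraph F\<close> \<open>arcs F = T'\<close>
        \<open>tail F = tail G\<close> \<open>head F = head G\<close> by simp
  qed
  have "w \<rightarrow>\<^sup>*\<^bsub>bidirect ?F\<^esub> w'" if "w \<in> verts G" "w' \<in> verts G" for w w'
  proof -
    have "v0 \<rightarrow>\<^sup>*\<^bsub>bidirect ?F\<^esub> w" "v0 \<rightarrow>\<^sup>*\<^bsub>bidirect ?F\<^esub> w'"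
      using that reach component[OF wf, of T] by (auto simp flip: component_of_vertex_iff)
    then show ?thesis
      using wf_digraph.reachable_trans[OF wf_digraph_bidirect[OF wf]] reachable_bidirect_sym by metis
  qed
  then have "Digraph_Component.connected ?F"
    unfolding Digraph_Component.connected_def using v0
    by (auto simp: strongly_connected_def reachable_mk_symmetric_iff_bidirect)
  moreover have "tail G e \<in> component_of_vertex (pre_digraph.del_arc ?F e) v0" if "e \<in> T" for e
    using tail_reached[OF that] component[OF wf_del, of e "T - {e}"]
    by (auto simp: pre_digraph.del_arc_simps)
  moreover have "spanning ?F G"
    unfolding spanning_def using T wf wf_digraph by (auto intro!: subgraphI simp: compatible_def)
  ultimately show ?thesis
    using acyclic v0 by (simp add: spanning_arborescence_def arborescence_def undirected_tree_def)
qed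

lemma exists_spanning_arborescence:
  assumes fin: "fin_digraph G" and v0: "v0 \<in> verts G" and H: "H \<subseteq> arcs G"
    and reach: "verts G \<subseteq> reach G H v0"
  obtains T where "T \<subseteq> H" "spanning_arborescence G v0 T"
proof -
  interpret fin_digraph G by fact
  define \<T> where "\<T> = {T. T \<subseteq> H \<and> verts G \<subseteq> reach G T v0}"
  have "finite \<T>"
    unfolding \<T>_def using H finite_subset[OF H] by simp
  moreover have "\<T> \<noteq> {}"
    unfolding \<T>_def using reach by blast
  ultimately obtain T where "T \<in> \<T>" and min: "\<And>T'. T' \<in> \<T> \<Longrightarrow> T' \<subseteq> T \<Longrightarrow> T = T'"
    by (meson finite_has_minimal)
  then have T: "T \<subseteq> H" "verts G \<subseteq> reach G T v0"
    by (auto simp: \<T>_def)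
  have "spanning_arborescence G v0 T"
  proof (rule spanning_arborescence_if_minimal_reaching[OF fin v0 _ T(2)])
    show "T \<subseteq> arcs G"
      using T(1) H by (rule subset_trans)
    show "\<not> verts G \<subseteq> reach G (T - {e}) v0" if "e \<in> T" for e
      using min[of "T - {e}"] T(1) that by (auto simp: \<T>_def)
  qed
  then show thesis using T(1) that by blast
qed

section \<open>Potentials and cuts\<close>

text \<open>The potential difference along an edge. For the indicator function of a vertex set it is the
  signed incidence vector of the cut: \<open>1\<close> on entering and \<open>-1\<close> on leaving edges.\<close>

definition coboundary :: "('v, 'e) pre_digraph \<Rightarrow> ('v \<Rightarrow> real) \<Rightarrow> 'e \<Rightarrow> real" where
  "coboundary G f e = f (head G e) - f (tail G e)"

definition cut :: "('v, 'e) pre_digraph \<Rightarrow> 'v set \<Rightarrow> 'e set" where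
  "cut G S = {e \<in> arcs G. tail G e \<in> S \<longleftrightarrow> head G e \<notin> S}"

lemma coboundary_indicator_nonzero_iff:
  "e \<in> arcs G \<Longrightarrow> coboundary G (indicator S) e \<noteq> 0 \<longleftrightarrow> e \<in> cut G S"
  by (auto simp: coboundary_def cut_def indicator_def)

lemma (in wf_digraph) edges_between_complements:
  assumes "vertex_bipartition G V1 V2"
  shows "edges_from_to G V1 V2 \<union> edges_from_to G V2 V1 = cut G V2"
  using assms tail_in_verts head_in_verts
  by (fastforce simp: vertex_bipartition_def edges_from_to_def cut_def)

lemma (in wf_digraph) is_cut_iff: "is_cut G C \<longleftrightarrow> (\<exists>S\<subseteq>verts G. C = cut G S)"
proof
  assume "is_cut G C"
  then show "\<exists>S\<subseteq>verts G. C = cut G S"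
    unfolding is_cut_def by (metis edges_between_complements sup_ge2 vertex_bipartition_def)
next
  assume "\<exists>S\<subseteq>verts G. C = cut G S"
  then obtain S where S: "S \<subseteq> verts G" "C = cut G S" by blast
  then have "vertex_bipartition G (verts G - S) S"
    by (auto simp: vertex_bipartition_def)
  with S(2) show "is_cut G C"
    unfolding is_cut_def using edges_between_complements by blast
qed

lemma (in wf_digraph) cut_complement: "cut G (verts G - S) = cut G S"
  by (auto simp: cut_def)

lemma (in wf_digraph) trivial_if_cut_empty:
  assumes "Digraph_Component.connected G" "S \<subseteq> verts G" "cut G S = {}"
  shows "S = {} \<or> S = verts G"
proof -
  have "verts G \<subseteq> S" if "u \<in> S" for u
    by (rule verts_subset_if_closed[OF assms(1), of u]) (use assms that in \<open>auto simp: cut_def\<close>)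
  then show ?thesis using assms(2) by blast
qed

locale oriented_dual = fin_digraph G for G :: "('v, 'e) pre_digraph" +
  fixes a :: "'e \<Rightarrow> real ^ 'n"
  assumes connected: "Digraph_Component.connected G"
    and unimodular: "totally_unimodular (arcs G) a"
    and represents: "represents_oriented_dual G a"
begin

definition relation :: "('e \<Rightarrow> real) \<Rightarrow> bool" where
  "relation l \<longleftrightarrow> (\<Sum>e\<in>arcs G. l e *\<^sub>R a e) = 0"

lemma relation_add: "relation l \<Longrightarrow> relation m \<Longrightarrow> relation (\<lambda>e. l e + m e)"
  by (simp add: relation_def scaleR_left_distrib sum.distrib)

lemma relation_mult: "relation l \<Longrightarrow> relation (\<lambda>e. t * l e)"
  by (simp add: relation_def flip: scaleR_scaleR scaleR_sum_right)

lemma relation_cong: "(\<And>e. e \<in> arcs G \<Longrightarrow> l e = m e) \<Longrightarrow> relation l \<longleftrightarrow> relation m"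
  by (simp add: relation_def)

text \<open>An elementary cut carries a relation with the prescribed signs, whose coefficients have equal
  modulus.\<close>

lemma relation_elementary_cut:
  assumes V: "vertex_bipartition G V1 V2" and elem: "elementary_cut G (cut G V2)"
  shows "relation (coboundary G (indicator V2))"
proof -
  let ?Cp = "edges_from_to G V1 V2" and ?Cm = "edges_from_to G V2 V1"
  define C where "C = cut G V2"
  have C: "C = ?Cp \<union> ?Cm" "C \<subseteq> arcs G"
    unfolding C_def edges_between_complements[OF V] by (auto simp: cut_def)
  have "signed_elementary_cut G ?Cp ?Cm"
    unfolding signed_elementary_cut_def using V elem edges_between_complements[OF V] by metis
  then have "signed_circuit (arcs G) a ?Cp ?Cm"
    using represents by (simp add: represents_oriented_dual_def)
  then obtain l where circ: "circuit (arcs G) a C" and l: "(\<Sum>i\<in>C. l i *\<^sub>R a i) = 0"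
    and pos: "\<forall>i\<in>?Cp. l i > 0" and neg: "\<forall>i\<in>?Cm. l i < 0"
    unfolding C(1) signed_circuit_def by blast
  obtain k where k: "k \<in> C"
    using elem unfolding elementary_cut_def C_def by blast
  have "\<bar>l k\<bar> > 0"
    using k pos neg unfolding C(1) by auto
  have l_eq: "l e = \<bar>l k\<bar> * coboundary G (indicator V2) e" if e: "e \<in> C" for e
  proof -
    have "\<bar>l e\<bar> = \<bar>l k\<bar>"
      by (rule circuit_dependency_constant_modulus[OF unimodular finite_arcs circ l e k])
    moreover have "V1 \<inter> V2 = {}"
      using V by (simp add: vertex_bipartition_def)
    ultimately show ?thesis
      using e pos neg unfolding C(1)
      by (force simp: edges_from_to_def coboundary_def indicator_def)
  qed
  have "(\<Sum>e\<in>arcs G. coboundary G (indicator V2) e *\<^sub>R a e) = (\<Sum>e\<in>C. coboundary G (indicator V2) e *\<^sub>R a e)"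
    by (rule sum.mono_neutral_right)
      (use C(2) in \<open>auto simp: C_def simp flip: coboundary_indicator_nonzero_iff\<close>)
  also have "\<bar>l k\<bar> *\<^sub>R \<dots> = 0"
    using l l_eq by (simp add: scaleR_sum_right)
  finally show ?thesis
    using \<open>\<bar>l k\<bar> > 0\<close> by (simp add: relation_def)
qed

lemma relation_complement:
  assumes "relation (coboundary G (indicator (verts G - S)))"
  shows "relation (coboundary G (indicator S))"
  using relation_mult[OF assms, of "-1"]
  by (subst relation_cong[of _ "\<lambda>e. -1 * coboundary G (indicator (verts G - S)) e"])
    (auto simp: coboundary_def indicator_def)

text \<open>Induction on the size of the cut. If the cut of \<open>S'\<close> is a proper nonempty part of the cut of \<open>S\<close>, then
  each of \<open>S\<close> and its complement is split by \<open>S'\<close> into two parts without edges between them; the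
  cut vector is the sum of the cut vectors of the two parts. At least one of the two splittings is
  proper, and then connectedness makes both cuts smaller.\<close>

lemma relation_cut:
  assumes "S \<subseteq> verts G"
  shows "relation (coboundary G (indicator S))"
  using assms
proof (induction "card (cut G S)" arbitrary: S rule: less_induct)
  case less
  have fin: "finite (cut G U)" for U
    by (rule finite_subset[of _ "arcs G"]) (auto simp: cut_def)
  consider (empty) "cut G S = {}" | (elem) "elementary_cut G (cut G S)"
    | (split) S' where "S' \<subseteq> verts G" "cut G S' \<noteq> {}" "cut G S' \<subset> cut G S"
    using less.prems unfolding elementary_cut_def is_cut_iff by blast
  then show ?case
  proof cases
    case empty
    then have "coboundary G (indicator S) e = 0" if "e \<in> arcs G" for e
      using coboundary_indicator_nonzero_iff[OF that, of S] by simp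
    then show ?thesis by (simp add: relation_def)
  next
    case elem
    then show ?thesis
      using less.prems by (intro relation_elementary_cut[of "verts G - S"]) (auto simp: vertex_bipartition_def)
  next
    case split
    have trivial_cuts: "cut G {} = {}" "cut G (verts G) = {}"
      by (auto simp: cut_def)
    have split_off: "relation (coboundary G (indicator U))"
      if U: "U \<subseteq> verts G" "cut G U = cut G S" "U \<inter> S' \<noteq> {}" "U - S' \<noteq> {}" for U
    proof -
      have U_proper: "U \<noteq> verts G"
        using U(2) split(3) trivial_cuts by blast
      have sub: "cut G (U \<inter> S') \<subseteq> cut G S" "cut G (U - S') \<subseteq> cut G S"
        and disj: "cut G (U \<inter> S') \<inter> cut G (U - S') = {}"
        using split(3) unfolding U(2)[symmetric] by (auto simp: cut_def)
      have "cut G (U \<inter> S') \<noteq> {}" "cut G (U - S') \<noteq> {}"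
        using trivial_if_cut_empty[OF connected, of "U \<inter> S'"] trivial_if_cut_empty[OF connected, of "U - S'"]
          U U_proper by blast+
      with sub disj have "cut G (U \<inter> S') \<subset> cut G S" "cut G (U - S') \<subset> cut G S"
        by blast+
      then have "relation (coboundary G (indicator (U \<inter> S')))" "relation (coboundary G (indicator (U - S')))"
        using U(1) fin by (auto intro!: less.hyps psubset_card_mono)
      from relation_add[OF this] show ?thesis
        by (rule relation_cong[THEN iffD1, rotated]) (auto simp: coboundary_def indicator_def)
    qed
    have "S' \<noteq> {}" "S' \<noteq> verts G" "S' \<noteq> S" "S' \<noteq> verts G - S"
      using split(2,3) trivial_cuts cut_complement[of S] by fastforce+
    then consider "S \<inter> S' \<noteq> {}" "S - S' \<noteq> {}" | "(verts G - S) \<inter> S' \<noteq> {}" "(verts G - S) - S' \<noteq> {}"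
      using less.prems split(1) by blast
    then show ?thesis
    proof cases
      case 1
      then show ?thesis using less.prems split_off by blast
    next
      case 2
      then have "relation (coboundary G (indicator (verts G - S)))"
        using split_off[of "verts G - S"] cut_complement[of S] by blast
      then show ?thesis by (rule relation_complement)
    qed
  qed
qed

text \<open>A potential is a linear combination of indicator functions of single vertices.\<close>

lemma relation_coboundary: "relation (coboundary G f)"
proof -
  have "relation (coboundary G (\<lambda>v. \<Sum>w\<in>W. f w * indicator {w} v))" if "W \<subseteq> verts G" for W
    using finite_subset[OF that finite_verts] that
  proof (induction W rule: finite_induct)
    case empty
    then show ?case by (simp add: relation_def coboundary_def)
  next
    case (insert w W)
    have "relation (\<lambda>e. f w * coboundary G (indicator {w}) e + coboundary G (\<lambda>v. \<Sum>w\<in>W. f w * indicator {w} v) e)"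
      using insert by (intro relation_add relation_mult relation_cut) auto
    then show ?case
      by (rule relation_cong[THEN iffD1, rotated])
        (simp only: coboundary_def sum.insert[OF insert.hyps] algebra_simps)
  qed
  from this[OF subset_refl] have "relation (coboundary G (\<lambda>v. \<Sum>w\<in>verts G. f w * indicator {w} v))" .
  moreover have "(\<Sum>w\<in>verts G. f w * indicator {w} v) = f v" if "v \<in> verts G" for v
  proof -
    have "(\<Sum>w\<in>verts G. f w * indicator {w} v) = (\<Sum>w\<in>verts G. if v = w then f w else 0)"
      by (rule sum.cong) (auto simp: indicator_def)
    then show ?thesis using that by simp
  qed
  then have "coboundary G (\<lambda>v. \<Sum>w\<in>verts G. f w * indicator {w} v) e = coboundary G f e"
    if "e \<in> arcs G" for e
    using that by (simp add: coboundary_def)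
  ultimately show ?thesis
    using relation_cong by blast
qed

lemma signed_elementary_cut_in_support:
  assumes l: "relation l" and nonzero: "e \<in> arcs G" "l e \<noteq> 0"
  obtains V1 V2 where "vertex_bipartition G V1 V2" "elementary_cut G (cut G V2)"
    "cut G V2 \<subseteq> {e \<in> arcs G. l e \<noteq> 0}"
proof -
  define X where "X = {e \<in> arcs G. l e \<noteq> 0}"
  have X: "X \<subseteq> arcs G" "finite X"
    by (auto simp: X_def)
  have "(\<Sum>i\<in>X. l i *\<^sub>R a i) = (\<Sum>i\<in>arcs G. l i *\<^sub>R a i)"
    by (rule sum.mono_neutral_left) (auto simp: X_def)
  then have "dependent_family a X"
    unfolding dependent_family_def using l nonzero
    by (intro exI[of _ l]) (auto simp: relation_def X_def)
  define \<C> where "\<C> = {C. C \<subseteq> X \<and> dependent_family a C}"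
  have "finite \<C>" "\<C> \<noteq> {}"
    using X(2) \<open>dependent_family a X\<close> by (auto simp: \<C>_def)
  then obtain C where "C \<in> \<C>" and min: "\<And>C'. C' \<in> \<C> \<Longrightarrow> C' \<subseteq> C \<Longrightarrow> C = C'"
    by (meson finite_has_minimal)
  then have C: "C \<subseteq> X" "dependent_family a C"
    by (auto simp: \<C>_def)
  then have circ: "circuit (arcs G) a C"
    unfolding circuit_def
  proof (intro conjI allI impI)
    show "C \<subseteq> arcs G" using C(1) X(1) by blast
    show "\<not> dependent_family a C'" if "C' \<subset> C" for C'
      using min[of C'] that C(1) by (auto simp: \<C>_def)
  qed
  have finC: "finite C"
    using C(1) X(2) by (rule finite_subset)
  obtain m where m: "(\<Sum>i\<in>C. m i *\<^sub>R a i) = 0" "\<exists>i\<in>C. m i \<noteq> 0"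
    using C(2) by (auto simp: dependent_family_def)
  have m_nonzero: "m i \<noteq> 0" if "i \<in> C" for i
    using circuit_dependency_vanishes[OF circ finC m(1) that] m(2) by blast
  have C_signs: "{i \<in> C. m i > 0} \<union> {i \<in> C. m i < 0} = C"
    using m_nonzero by (auto simp: neq_iff)
  have "signed_circuit (arcs G) a {i \<in> C. m i > 0} {i \<in> C. m i < 0}"
    unfolding signed_circuit_def C_signs using circ m(1) by auto
  then have "signed_elementary_cut G {i \<in> C. m i > 0} {i \<in> C. m i < 0}"
    using represents by (simp add: represents_oriented_dual_def)
  then obtain V1 V2 where V: "vertex_bipartition G V1 V2" "elementary_cut G C"
    and "C = edges_from_to G V1 V2 \<union> edges_from_to G V2 V1"
    unfolding signed_elementary_cut_def using C_signs by metis
  then have "C = cut G V2"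
    using edges_between_complements by metis
  then show thesis
    using that V C(1) by (auto simp: X_def)
qed

text \<open>Subtracting a multiple of the vector of an elementary cut inside the support of the relation
  makes the support smaller.\<close>

lemma coboundary_if_relation:
  assumes "relation l"
  shows "\<exists>f. \<forall>e\<in>arcs G. l e = coboundary G f e"
  using assms
proof (induction "card {e \<in> arcs G. l e \<noteq> 0}" arbitrary: l rule: less_induct)
  case less
  show ?case
  proof (cases "\<exists>e\<in>arcs G. l e \<noteq> 0")
    case False
    then show ?thesis
      by (intro exI[of _ "\<lambda>_. 0"]) (simp add: coboundary_def)
  next
    case True
    then obtain V1 V2 where V: "vertex_bipartition G V1 V2" "elementary_cut G (cut G V2)"
      and sub: "cut G V2 \<subseteq> {e \<in> arcs G. l e \<noteq> 0}"
      using signed_elementary_cut_in_support[OF less.prems] by blast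
    let ?\<delta> = "coboundary G (indicator V2)"
    obtain k where k: "k \<in> cut G V2"
      using V(2) unfolding elementary_cut_def by blast
    then have k': "k \<in> arcs G" "?\<delta> k \<noteq> 0" "l k \<noteq> 0"
      using sub coboundary_indicator_nonzero_iff[of k G V2] by auto
    define t where "t = l k / ?\<delta> k"
    define l' where "l' e = l e + (- t) * ?\<delta> e" for e
    have "relation l'"
      unfolding l'_def
      by (intro relation_add less.prems relation_mult relation_elementary_cut[OF V])
    moreover have "{e \<in> arcs G. l' e \<noteq> 0} \<subset> {e \<in> arcs G. l e \<noteq> 0}"
    proof (rule psubsetI)
      show "{e \<in> arcs G. l' e \<noteq> 0} \<subseteq> {e \<in> arcs G. l e \<noteq> 0}"
      proof
        fix e assume e: "e \<in> {e \<in> arcs G. l' e \<noteq> 0}"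
        show "e \<in> {e \<in> arcs G. l e \<noteq> 0}"
        proof (cases "e \<in> cut G V2")
          case True
          then show ?thesis using sub by blast
        next
          case False
          then have "?\<delta> e = 0"
            using e coboundary_indicator_nonzero_iff[of e G V2] by blast
          then show ?thesis using e by (simp add: l'_def)
        qed
      qed
      have "l' k = 0"
        using k' by (simp add: l'_def t_def)
      then show "{e \<in> arcs G. l' e \<noteq> 0} \<noteq> {e \<in> arcs G. l e \<noteq> 0}"
        using k' by blast
    qed
    then have "card {e \<in> arcs G. l' e \<noteq> 0} < card {e \<in> arcs G. l e \<noteq> 0}"
      by (intro psubset_card_mono) auto
    ultimately obtain f where f: "\<forall>e\<in>arcs G. l' e = coboundary G f e"
      using less.hyps by blast
    have "l e = coboundary G (\<lambda>v. f v + t * indicator V2 v) e" if "e \<in> arcs G" for e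
      using bspec[OF f that] by (simp add: l'_def coboundary_def algebra_simps)
    then show ?thesis by blast
  qed
qed

end

section \<open>Eulerian digraphs\<close>

lemma (in fin_digraph) sum_head_eq_sum_in_degree:
  "(\<Sum>e\<in>arcs G. f (head G e)) = (\<Sum>v\<in>verts G. real (in_degree G v) * f v)"
proof -
  have "(\<Sum>e\<in>arcs G. f (head G e)) = (\<Sum>v\<in>verts G. \<Sum>e\<in>{e \<in> arcs G. head G e = v}. f (head G e))"
    by (rule sum.group[symmetric]) auto
  then show ?thesis
    by (simp add: in_degree_def in_arcs_def)
qed

lemma (in fin_digraph) sum_tail_eq_sum_out_degree:
  "(\<Sum>e\<in>arcs G. f (tail G e)) = (\<Sum>v\<in>verts G. real (out_degree G v) * f v)"
proof -
  have "(\<Sum>e\<in>arcs G. f (tail G e)) = (\<Sum>v\<in>verts G. \<Sum>e\<in>{e \<in> arcs G. tail G e = v}. f (tail G e))"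
    by (rule sum.group[symmetric]) auto
  then show ?thesis
    by (simp add: out_degree_def out_arcs_def)
qed

lemma eulerian_sum_coboundary:
  assumes "eulerian_digraph G"
  shows "(\<Sum>e\<in>arcs G. coboundary G f e) = 0"
proof -
  interpret fin_digraph G using assms by (simp add: eulerian_digraph_def)
  show ?thesis
    using assms unfolding eulerian_digraph_def coboundary_def
    by (simp add: sum_subtractf sum_head_eq_sum_in_degree sum_tail_eq_sum_out_degree)
qed

text \<open>If no edge leaves \<open>R\<close>, the potential differences of its indicator function are nonnegative, and
  since they sum to zero no edge enters \<open>R\<close> either.\<close>

lemma eulerian_leaving_arc:
  assumes G: "eulerian_digraph G" and u: "u \<in> verts G" "u \<in> R" and R: "\<not> verts G \<subseteq> R"
  obtains e where "e \<in> arcs G" "tail G e \<in> R" "head G e \<notin> R"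
proof (rule ccontr)
  interpret fin_digraph G using G by (simp add: eulerian_digraph_def)
  assume "\<not> thesis"
  then have stay: "head G e \<in> R" if "e \<in> arcs G" "tail G e \<in> R" for e
    using that \<open>\<And>e. e \<in> arcs G \<Longrightarrow> tail G e \<in> R \<Longrightarrow> head G e \<notin> R \<Longrightarrow> thesis\<close> by blast
  have "\<forall>e\<in>arcs G. coboundary G (indicator R) e = 0"
    by (subst sum_nonneg_eq_0_iff[symmetric])
      (use stay eulerian_sum_coboundary[OF G] in \<open>auto simp: coboundary_def indicator_def\<close>)
  then have "tail G e \<in> R \<longleftrightarrow> head G e \<in> R" if "e \<in> arcs G" for e
    using that by (fastforce simp: coboundary_def indicator_def split: if_splits)
  then have "verts G \<subseteq> R"
    using verts_subset_if_closed[of G u R] G u by (auto simp: eulerian_digraph_def)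
  with R show False ..
qed

text \<open>Distances from \<open>v0\<close> for the edge lengths \<open>x\<close> are such a potential. As in the algorithm of
  Dijkstra, it is obtained by raising the potential outside the set that is reachable by tight
  edges until an edge leaving this set becomes tight.\<close>

lemma eulerian_tight_potential:
  assumes G: "eulerian_digraph G" and v0: "v0 \<in> verts G" and x: "\<And>e. e \<in> arcs G \<Longrightarrow> 0 \<le> x e"
  obtains f where "\<And>e. e \<in> arcs G \<Longrightarrow> coboundary G f e \<le> x e"
    "verts G \<subseteq> reach G {e \<in> arcs G. coboundary G f e = x e} v0"
proof -
  interpret fin_digraph G using G by (simp add: eulerian_digraph_def)
  define R where "R f = reach G {e \<in> arcs G. coboundary G f e = x e} v0" for f
  have "\<exists>f'. (\<forall>e\<in>arcs G. coboundary G f' e \<le> x e) \<and> verts G \<subseteq> R f'"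
    if "\<forall>e\<in>arcs G. coboundary G f e \<le> x e" for f
    using that
  proof (induction "card (verts G - R f)" arbitrary: f rule: less_induct)
    case less
    show ?case
    proof (cases "verts G \<subseteq> R f")
      case True
      with less.prems show ?thesis by blast
    next
      case False
      define L where "L = {e \<in> arcs G. tail G e \<in> R f \<and> head G e \<notin> R f}"
      define slack where "slack e = x e - coboundary G f e" for e
      have "v0 \<in> R f"
        by (simp add: R_def reach_refl)
      then have "L \<noteq> {}" "finite L"
        using eulerian_leaving_arc[OF G v0 _ False] by (auto simp: L_def)
      then obtain e0 where e0: "e0 \<in> L" "\<And>e. e \<in> L \<Longrightarrow> slack e0 \<le> slack e"
        by (metis arg_min_if_finite(1) arg_min_least)
      define f' where "f' v = f v + (if v \<in> R f then 0 else slack e0)" for v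
      have "slack e0 \<ge> 0"
        using e0(1) less.prems by (auto simp: L_def slack_def)
      have feasible: "\<forall>e\<in>arcs G. coboundary G f' e \<le> x e"
      proof
        fix e assume e: "e \<in> arcs G"
        show "coboundary G f' e \<le> x e"
        proof (cases "e \<in> L")
          case True
          then show ?thesis
            using e0(2)[OF True] by (simp add: L_def f'_def slack_def coboundary_def)
        next
          case False
          then show ?thesis
            using bspec[OF less.prems e] e \<open>slack e0 \<ge> 0\<close>
            by (auto simp: L_def f'_def coboundary_def split: if_splits)
        qed
      qed
      have "R f \<subseteq> R f \<inter> R f'"
        unfolding R_def[of f]
      proof (rule reach_least)
        show "v0 \<in> reach G {e \<in> arcs G. coboundary G f e = x e} v0 \<inter> R f'"
          by (simp add: R_def reach_refl)
        fix e assume e: "e \<in> {e \<in> arcs G. coboundary G f e = x e}"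
          "tail G e \<in> reach G {e \<in> arcs G. coboundary G f e = x e} v0 \<inter> R f'"
        then have head: "head G e \<in> R f" and tail: "tail G e \<in> R f"
          unfolding R_def by (auto intro: reach_step)
        then have "coboundary G f' e = x e"
          using e(1) by (simp add: f'_def coboundary_def)
        then have "head G e \<in> R f'"
          using e unfolding R_def by (auto intro: reach_step)
        with head show "head G e \<in> reach G {e \<in> arcs G. coboundary G f e = x e} v0 \<inter> R f'"
          by (simp add: R_def)
      qed
      moreover have "head G e0 \<in> R f'"
        unfolding R_def
      proof (rule reach_step)
        show "e0 \<in> {e \<in> arcs G. coboundary G f' e = x e}"
          using e0(1) by (simp add: L_def f'_def slack_def coboundary_def)
        show "tail G e0 \<in> reach G {e \<in> arcs G. coboundary G f' e = x e} v0"
          using e0(1) \<open>R f \<subseteq> R f \<inter> R f'\<close> by (auto simp: L_def R_def)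
      qed
      moreover have "head G e0 \<in> verts G - R f"
        using e0(1) by (simp add: L_def)
      ultimately have "verts G - R f' \<subset> verts G - R f"
        by blast
      then have "card (verts G - R f') < card (verts G - R f)"
        by (intro psubset_card_mono) auto
      then show ?thesis
        using less.hyps feasible by blast
    qed
  qed
  from this[of "\<lambda>_. 0"] x obtain f where "\<forall>e\<in>arcs G. coboundary G f e \<le> x e" "verts G \<subseteq> R f"
    by (auto simp: coboundary_def)
  then show thesis
    using that unfolding R_def by blast
qed

section \<open>Triangulations from unique coordinates\<close>

text \<open>Weights are indexed by all of \<open>E\<close>, although only those on \<open>B\<close> can be nonzero; so the weights of
  a point in different simplices can be compared.\<close>

definition weights_on :: "'e set \<Rightarrow> 'e set \<Rightarrow> ('e \<Rightarrow> real) \<Rightarrow> bool" where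
  "weights_on E B x \<longleftrightarrow> (\<forall>e\<in>E. 0 \<le> x e) \<and> (\<forall>e\<in>E - B. x e = 0)"

lemma convex_hull_image_eq:
  fixes a :: "'e \<Rightarrow> 'b::real_vector"
  assumes "finite B"
  shows "convex hull (a ` B) = {\<Sum>e\<in>B. x e *\<^sub>R a e | x. (\<forall>e\<in>B. 0 \<le> x e) \<and> sum x B = 1}"
    (is "_ = ?R")
proof
  show "?R \<subseteq> convex hull (a ` B)"
  proof clarify
    fix x :: "'e \<Rightarrow> real" assume "\<forall>e\<in>B. 0 \<le> x e" "sum x B = 1"
    then show "(\<Sum>e\<in>B. x e *\<^sub>R a e) \<in> convex hull (a ` B)"
      by (intro convex_sum[OF assms convex_convex_hull]) (auto intro: hull_inc)
  qed
  have "y \<in> ?R" if "y \<in> a ` B" for y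
  proof -
    from that obtain e where e: "e \<in> B" "y = a e" by blast
    then show ?thesis
      using assms
      by (intro CollectI exI[of _ "\<lambda>i. if i = e then 1 else 0"])
        (simp add: if_distrib[of "\<lambda>t. t *\<^sub>R _"] cong: if_cong)
  qed
  moreover have "convex ?R"
  proof (rule convexI)
    fix y z u v :: "'b" and s t :: real
    assume "y \<in> ?R" "z \<in> ?R" and st: "0 \<le> s" "0 \<le> t" "s + t = 1"
    then obtain p q where p: "y = (\<Sum>e\<in>B. p e *\<^sub>R a e)" "\<forall>e\<in>B. 0 \<le> p e" "sum p B = 1"
      and q: "z = (\<Sum>e\<in>B. q e *\<^sub>R a e)" "\<forall>e\<in>B. 0 \<le> q e" "sum q B = 1"
      by blast
    show "s *\<^sub>R y + t *\<^sub>R z \<in> ?R"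
      using p q st
      by (intro CollectI exI[of _ "\<lambda>e. s * p e + t * q e"])
        (simp add: scaleR_left_distrib sum.distrib scaleR_sum_right flip: sum_distrib_left)
  qed
  ultimately show "convex hull (a ` B) \<subseteq> ?R"
    by (intro hull_minimal) auto
qed

lemma Delta_eq:
  assumes "finite E" "B \<subseteq> E"
  shows "Delta a B = {\<Sum>e\<in>E. x e *\<^sub>R a e | x. weights_on E B x \<and> sum x E = 1}"
proof -
  have B: "finite B" using assms by (auto intro: finite_subset)
  show ?thesis
    unfolding Delta_def convex_hull_image_eq[OF B]
  proof (intro subset_antisym subsetI)
    fix y assume "y \<in> {\<Sum>e\<in>B. x e *\<^sub>R a e | x. (\<forall>e\<in>B. 0 \<le> x e) \<and> sum x B = 1}"
    then obtain x where x: "y = (\<Sum>e\<in>B. x e *\<^sub>R a e)" "\<forall>e\<in>B. 0 \<le> x e" "sum x B = 1"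
      by blast
    let ?x = "\<lambda>e. if e \<in> B then x e else 0"
    have "sum ?x E = sum x B" "(\<Sum>e\<in>E. ?x e *\<^sub>R a e) = (\<Sum>e\<in>B. x e *\<^sub>R a e)"
      using assms by (auto intro!: sum.mono_neutral_cong_right)
    then show "y \<in> {\<Sum>e\<in>E. x e *\<^sub>R a e | x. weights_on E B x \<and> sum x E = 1}"
      using x by (intro CollectI exI[of _ ?x]) (auto simp: weights_on_def)
  next
    fix y assume "y \<in> {\<Sum>e\<in>E. x e *\<^sub>R a e | x. weights_on E B x \<and> sum x E = 1}"
    then obtain x where x: "y = (\<Sum>e\<in>E. x e *\<^sub>R a e)" "weights_on E B x" "sum x E = 1"
      by blast
    have "sum x E = sum x B" "(\<Sum>e\<in>E. x e *\<^sub>R a e) = (\<Sum>e\<in>B. x e *\<^sub>R a e)"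
      using assms x(2) by (auto simp: weights_on_def intro!: sum.mono_neutral_right)
    then show "y \<in> {\<Sum>e\<in>B. x e *\<^sub>R a e | x. (\<forall>e\<in>B. 0 \<le> x e) \<and> sum x B = 1}"
      using x assms(2) by (intro CollectI exI[of _ x]) (auto simp: weights_on_def)
  qed
qed

text \<open>A criterion for \<open>D\<close> to index a triangulation. In \<open>unique\<close>, the two index sets may differ; this
  is what makes the simplices fit together.\<close>

locale unique_coordinates =
  fixes E :: "'e set" and a :: "'e \<Rightarrow> real ^ 'n" and D :: "'e set set"
  assumes finite_E: "finite E"
    and D_subsets: "B \<in> D \<Longrightarrow> B \<subseteq> E"
    and spanning: "B \<in> D \<Longrightarrow> e \<in> E \<Longrightarrow> a e \<in> affine hull (a ` B)"
    and covering: "weights_on E E x \<Longrightarrow>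
      \<exists>B\<in>D. \<exists>x'. weights_on E B x' \<and> sum x' E = sum x E \<and> (\<Sum>e\<in>E. x' e *\<^sub>R a e) = (\<Sum>e\<in>E. x e *\<^sub>R a e)"
    and unique: "B \<in> D \<Longrightarrow> B' \<in> D \<Longrightarrow> weights_on E B x \<Longrightarrow> weights_on E B' x' \<Longrightarrow>
      (\<Sum>e\<in>E. x e *\<^sub>R a e) = (\<Sum>e\<in>E. x' e *\<^sub>R a e) \<Longrightarrow> e \<in> E \<Longrightarrow> x e = x' e"
begin

lemma inj_on_member:
  assumes B: "B \<in> D"
  shows "inj_on a B"
proof (rule inj_onI)
  fix e e' assume e: "e \<in> B" "e' \<in> B" "a e = a e'"
  have E: "e \<in> E" "e' \<in> E"
    using D_subsets[OF B] e by blast+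
  let ?x = "\<lambda>e i. if i = e then 1 else 0 :: real"
  have "(\<Sum>i\<in>E. ?x e i *\<^sub>R a i) = (\<Sum>i\<in>E. ?x e' i *\<^sub>R a i)"
    using E e(3) finite_E by (simp add: if_distrib[of "\<lambda>t. t *\<^sub>R _"] cong: if_cong)
  then have "?x e e = ?x e' e"
    by (rule unique[OF B B _ _ _ E(1), rotated 2]) (use e in \<open>auto simp: weights_on_def\<close>)
  then show "e = e'"
    by (simp split: if_splits)
qed

text \<open>Split an affine relation into its positive and negative parts: these are nonnegative weights on
  \<open>B\<close> that represent the same point.\<close>

lemma affine_independent_member:
  assumes B: "B \<in> D"
  shows "\<not> affine_dependent (a ` B)"
proof
  have BE: "B \<subseteq> E" using D_subsets[OF B] .
  have fin: "finite B" using BE finite_E by (rule finite_subset)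
  assume "affine_dependent (a ` B)"
  then obtain U where U: "\<exists>v\<in>a ` B. U v \<noteq> 0" "(\<Sum>v\<in>a ` B. U v *\<^sub>R v) = 0"
    using fin by (auto simp: affine_dependent_explicit_finite)
  \<comment> \<open>\<open>x 1\<close> is the positive and \<open>x (-1)\<close> the negative part of \<open>U\<close>\<close>
  define x where "x s e = (if e \<in> B then max (s * U (a e)) 0 else 0)" for s :: real and e
  have sum_x: "(\<Sum>e\<in>E. x s e *\<^sub>R a e) = (\<Sum>e\<in>B. max (s * U (a e)) 0 *\<^sub>R a e)" for s
    using BE finite_E by (auto simp: x_def intro!: sum.mono_neutral_cong_right)
  have "(\<Sum>e\<in>E. x 1 e *\<^sub>R a e) - (\<Sum>e\<in>E. x (-1) e *\<^sub>R a e) = (\<Sum>e\<in>B. U (a e) *\<^sub>R a e)"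
    unfolding sum_x sum_subtractf[symmetric] scaleR_left_diff_distrib[symmetric]
    by (rule sum.cong) (auto simp: max_def)
  also have "\<dots> = 0"
    using U(2) by (simp add: sum.reindex[OF inj_on_member[OF B]])
  finally have eq: "(\<Sum>e\<in>E. x 1 e *\<^sub>R a e) = (\<Sum>e\<in>E. x (-1) e *\<^sub>R a e)"
    by simp
  have w: "weights_on E B (x s)" for s
    by (auto simp: weights_on_def x_def)
  have "U (a e) = 0" if "e \<in> B" for e
  proof -
    have "x 1 e = x (-1) e"
      using unique[OF B B w w eq] that BE by blast
    then show ?thesis
      using that by (auto simp: x_def max_def split: if_splits)
  qed
  then show False using U(1) by blast
qed

lemma simplex_member:
  assumes B: "B \<in> D"
  shows "aff_dim (root_polytope E a) simplex Delta a B"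
proof -
  have "affine hull (a ` E) = affine hull (a ` B)"
  proof
    show "affine hull (a ` E) \<subseteq> affine hull (a ` B)"
      using spanning[OF B] by (intro hull_minimal) auto
    show "affine hull (a ` B) \<subseteq> affine hull (a ` E)"
      using D_subsets[OF B] by (intro hull_mono image_mono)
  qed
  then have "aff_dim (root_polytope E a) = aff_dim (a ` B)"
    unfolding root_polytope_def by (metis aff_dim_affine_hull aff_dim_convex_hull)
  then show ?thesis
    unfolding simplex_def Delta_def
    using affine_independent_member[OF B] aff_dim_affine_independent[OF affine_independent_member[OF B]]
    by (intro exI[of _ "a ` B"]) simp
qed

text \<open>Points of the relative interior have positive weights on all of \<open>B\<close>, so they determine \<open>B\<close>.\<close>

lemma rel_interior_member:
  assumes B: "B \<in> D" and y: "y \<in> rel_interior (Delta a B)"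
  obtains x where "weights_on E B x" "\<And>e. e \<in> E \<Longrightarrow> x e \<noteq> 0 \<longleftrightarrow> e \<in> B" "y = (\<Sum>e\<in>E. x e *\<^sub>R a e)"
proof -
  have BE: "B \<subseteq> E" using D_subsets[OF B] .
  obtain u where u: "\<forall>v\<in>a ` B. 0 < u v" "(\<Sum>v\<in>a ` B. u v *\<^sub>R v) = y"
    using y unfolding Delta_def rel_interior_convex_hull_explicit[OF affine_independent_member[OF B]]
    by blast
  let ?x = "\<lambda>e. if e \<in> B then u (a e) else 0"
  have "(\<Sum>e\<in>E. ?x e *\<^sub>R a e) = (\<Sum>e\<in>B. u (a e) *\<^sub>R a e)"
    using BE finite_E by (auto intro!: sum.mono_neutral_cong_right)
  also have "\<dots> = y"
    using u(2) by (simp add: sum.reindex[OF inj_on_member[OF B]])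
  finally show thesis
    using u(1) by (intro that[of ?x]) (auto simp: weights_on_def less_imp_le less_imp_neq[symmetric])
qed

lemma Delta_inter:
  assumes B: "B \<in> D" "B' \<in> D"
  shows "Delta a B \<inter> Delta a B' = Delta a (B \<inter> B')"
proof
  show "Delta a (B \<inter> B') \<subseteq> Delta a B \<inter> Delta a B'"
    unfolding Delta_def by (intro Int_greatest hull_mono) auto
  show "Delta a B \<inter> Delta a B' \<subseteq> Delta a (B \<inter> B')"
  proof
    fix y assume "y \<in> Delta a B \<inter> Delta a B'"
    then obtain x x' where x: "y = (\<Sum>e\<in>E. x e *\<^sub>R a e)" "weights_on E B x" "sum x E = 1"
      and x': "y = (\<Sum>e\<in>E. x' e *\<^sub>R a e)" "weights_on E B' x'"
      using Delta_eq[OF finite_E D_subsets] B by blast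
    then have "x e = x' e" if "e \<in> E" for e
      using unique[OF B x(2) x'(2) _ that] by simp
    then have "weights_on E (B \<inter> B') x"
      using x(2) x'(2) unfolding weights_on_def by (metis DiffE DiffI IntI)
    moreover have "B \<inter> B' \<subseteq> E"
      using D_subsets[OF B(1)] by blast
    ultimately show "y \<in> Delta a (B \<inter> B')"
      unfolding Delta_eq[OF finite_E \<open>B \<inter> B' \<subseteq> E\<close>] using x by blast
  qed
qed

lemma triangulation_of_root_polytope: "triangulation_of (root_polytope E a) D (Delta a)"
proof -
  have cover: "(\<Union>B\<in>D. Delta a B) = root_polytope E a"
  proof
    show "(\<Union>B\<in>D. Delta a B) \<subseteq> root_polytope E a"
      unfolding Delta_def root_polytope_def using D_subsets by (intro UN_least hull_mono image_mono)
    show "root_polytope E a \<subseteq> (\<Union>B\<in>D. Delta a B)"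
    proof
      fix y assume "y \<in> root_polytope E a"
      then have "y \<in> Delta a E"
        by (simp add: root_polytope_def Delta_def)
      then obtain x where x: "y = (\<Sum>e\<in>E. x e *\<^sub>R a e)" "weights_on E E x" "sum x E = 1"
        using Delta_eq[OF finite_E subset_refl] by blast
      then obtain B x' where "B \<in> D" "weights_on E B x'" "sum x' E = 1" "y = (\<Sum>e\<in>E. x' e *\<^sub>R a e)"
        using covering[OF x(2)] by auto
      then show "y \<in> (\<Union>B\<in>D. Delta a B)"
        using Delta_eq[OF finite_E D_subsets] by blast
    qed
  qed
  have disjoint: "rel_interior (Delta a B) \<inter> rel_interior (Delta a B') = {}"
    if B: "B \<in> D" "B' \<in> D" "B \<noteq> B'" for B B'
  proof (rule ccontr)
    assume "rel_interior (Delta a B) \<inter> rel_interior (Delta a B') \<noteq> {}"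
    then obtain y where y: "y \<in> rel_interior (Delta a B)" "y \<in> rel_interior (Delta a B')"
      by blast
    obtain x where x: "weights_on E B x" "\<And>e. e \<in> E \<Longrightarrow> x e \<noteq> 0 \<longleftrightarrow> e \<in> B" "y = (\<Sum>e\<in>E. x e *\<^sub>R a e)"
      using rel_interior_member[OF B(1) y(1)] by blast
    obtain x' where x': "weights_on E B' x'" "\<And>e. e \<in> E \<Longrightarrow> x' e \<noteq> 0 \<longleftrightarrow> e \<in> B'" "y = (\<Sum>e\<in>E. x' e *\<^sub>R a e)"
      using rel_interior_member[OF B(2) y(2)] by blast
    have "e \<in> B \<longleftrightarrow> e \<in> B'" if "e \<in> E" for e
      using unique[OF B(1,2) x(1) x'(1) _ that] x(2)[OF that] x'(2)[OF that] x(3) x'(3) by simp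
    then show False
      using B D_subsets by blast
  qed
  have faces: "Delta a B \<inter> Delta a B' face_of Delta a B" if B: "B \<in> D" "B' \<in> D" for B B'
    unfolding Delta_inter[OF B] unfolding Delta_def
    by (subst face_of_convex_hull_affine_independent[OF affine_independent_member[OF B(1)]])
      (intro exI[of _ "a ` (B \<inter> B')"], auto)
  have "finite D"
    using D_subsets finite_E by (intro finite_subset[of D "Pow E"]) auto
  then have "triangulation (Delta a ` D)"
    unfolding triangulation_def using simplex_member faces by blast
  then show ?thesis
    unfolding triangulation_of_def dissection_into_simplices_def
    using simplex_member cover disjoint by blast
qed

end

section \<open>Complements of spanning arborescences\<close>

lemma sum_in_affine_hull_image:
  fixes a :: "'e \<Rightarrow> 'b::real_vector"
  assumes "finite B" "sum m B = 1"
  shows "(\<Sum>b\<in>B. m b *\<^sub>R a b) \<in> affine hull (a ` B)"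
proof -
  define u where "u v = (\<Sum>b\<in>{b \<in> B. a b = v}. m b)" for v
  have "sum u (a ` B) = 1"
    unfolding u_def using assms sum.image_gen[OF assms(1), of m a] by simp
  moreover have "(\<Sum>v\<in>a ` B. u v *\<^sub>R v) = (\<Sum>b\<in>B. m b *\<^sub>R a b)"
    unfolding u_def sum.image_gen[OF assms(1), of "\<lambda>b. m b *\<^sub>R a b" a]
    by (intro sum.cong) (auto simp: scaleR_sum_left)
  ultimately show ?thesis
    using assms(1) by (auto simp: affine_hull_finite)
qed

context oriented_dual
begin

text \<open>The cut vector of the fundamental cut of \<open>e\<close> is a relation that involves \<open>e\<close> with coefficient
  \<open>-1\<close> and otherwise only elements of \<open>B\<close>. Its coefficients sum to zero, so those on \<open>B\<close> sum to
  \<open>1\<close>.\<close>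

lemma cotree_affinely_spanning:
  assumes eul: "eulerian_digraph G" and B: "B \<subseteq> arcs G" "spanning_arborescence G v0 (arcs G - B)"
    and e: "e \<in> arcs G"
  shows "a e \<in> affine hull (a ` B)"
proof (cases "e \<in> B")
  case True
  then show ?thesis by (simp add: hull_inc)
next
  case False
  with e have e_tree: "e \<in> arcs G - B" by blast
  obtain S where S: "v0 \<in> S" "tail G e \<in> S" "head G e \<notin> S"
    "\<And>e'. e' \<in> arcs G - B - {e} \<Longrightarrow> tail G e' \<in> S \<longleftrightarrow> head G e' \<in> S"
    using spanning_arborescence_fundamental_cut[OF B(2) e_tree] by blast
  let ?\<delta> = "coboundary G (indicator S)"
  have finB: "finite B" using B(1) by (rule finite_subset) simp
  have at_e: "?\<delta> e = -1"
    using S(2,3) by (simp add: coboundary_def)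
  have off: "?\<delta> e' = 0" if "e' \<in> arcs G - insert e B" for e'
    using S(4)[of e'] that by (simp add: coboundary_def indicator_def)
  have restrict: "(\<Sum>i\<in>arcs G. g i) = g e + (\<Sum>i\<in>B. g i)"
    if "\<And>i. i \<in> arcs G - insert e B \<Longrightarrow> g i = 0" for g :: "'e \<Rightarrow> 'z::comm_monoid_add"
  proof -
    have "(\<Sum>i\<in>arcs G. g i) = (\<Sum>i\<in>insert e B. g i)"
      by (rule sum.mono_neutral_right) (use e B(1) that in auto)
    then show ?thesis using finB False by simp
  qed
  have "(\<Sum>i\<in>B. ?\<delta> i) = 1"
    using restrict[of ?\<delta>] off at_e eulerian_sum_coboundary[OF eul, of "indicator S"] by simp
  moreover have "(\<Sum>i\<in>B. ?\<delta> i *\<^sub>R a i) = a e"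
    using restrict[of "\<lambda>i. ?\<delta> i *\<^sub>R a i"] off at_e relation_coboundary[of "indicator S"]
    by (simp add: relation_def)
  ultimately show ?thesis
    using sum_in_affine_hull_image[OF finB] by metis
qed

text \<open>Subtract the potential difference of a shortest path potential: the weights stay nonnegative and
  vanish on a spanning arborescence of tight edges.\<close>

lemma cotree_simplices_cover:
  assumes eul: "eulerian_digraph G" and v0: "v0 \<in> verts G" and x: "weights_on (arcs G) (arcs G) x"
  obtains B x' where "B \<subseteq> arcs G" "spanning_arborescence G v0 (arcs G - B)"
    "weights_on (arcs G) B x'" "sum x' (arcs G) = sum x (arcs G)"
    "(\<Sum>e\<in>arcs G. x' e *\<^sub>R a e) = (\<Sum>e\<in>arcs G. x e *\<^sub>R a e)"
proof -
  obtain f where f: "\<And>e. e \<in> arcs G \<Longrightarrow> coboundary G f e \<le> x e"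
    "verts G \<subseteq> reach G {e \<in> arcs G. coboundary G f e = x e} v0"
    using eulerian_tight_potential[OF eul v0, of x] x by (auto simp: weights_on_def)
  obtain T where T: "T \<subseteq> {e \<in> arcs G. coboundary G f e = x e}" "spanning_arborescence G v0 T"
    using exists_spanning_arborescence[OF fin_digraph_axioms v0 _ f(2)] by blast
  let ?x' = "\<lambda>e. x e - coboundary G f e"
  show thesis
  proof (rule that[of "arcs G - T" ?x'])
    have "arcs G - (arcs G - T) = T"
      using T(1) by blast
    then show "spanning_arborescence G v0 (arcs G - (arcs G - T))"
      using T(2) by simp
    show "weights_on (arcs G) (arcs G - T) ?x'"
      using f(1) T(1) by (auto simp: weights_on_def)
    show "sum ?x' (arcs G) = sum x (arcs G)"
      using eulerian_sum_coboundary[OF eul, of f] by (simp add: sum_subtractf)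
    show "(\<Sum>e\<in>arcs G. ?x' e *\<^sub>R a e) = (\<Sum>e\<in>arcs G. x e *\<^sub>R a e)"
      using relation_coboundary[of f] by (simp add: relation_def scaleR_left_diff_distrib sum_subtractf)
  qed blast
qed

text \<open>The two weight vectors differ by some \<open>\<delta>f\<close>; paths from \<open>v0\<close> in the first arborescence show that
  \<open>f\<close> is maximal at \<open>v0\<close>, and those in the second that it is minimal there.\<close>

lemma cotree_coordinates_unique:
  assumes B: "spanning_arborescence G v0 (arcs G - B)" "spanning_arborescence G v0 (arcs G - B')"
    and w: "weights_on (arcs G) B x" "weights_on (arcs G) B' x'"
    and eq: "(\<Sum>e\<in>arcs G. x e *\<^sub>R a e) = (\<Sum>e\<in>arcs G. x' e *\<^sub>R a e)"
    and e: "e \<in> arcs G"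
  shows "x e = x' e"
proof -
  have "relation (\<lambda>e. x e - x' e)"
    using eq by (simp add: relation_def scaleR_left_diff_distrib sum_subtractf)
  then obtain f where f: "\<forall>e\<in>arcs G. x e - x' e = coboundary G f e"
    using coboundary_if_relation by blast
  have "verts G \<subseteq> {v. f v \<le> f v0}"
  proof (rule subset_trans[OF spanning_arborescence_reaches_all[OF B(1)] reach_least])
    fix i assume i: "i \<in> arcs G - B" "tail G i \<in> {v. f v \<le> f v0}"
    then have "coboundary G f i \<le> 0"
      using bspec[OF f, of i] w by (force simp: weights_on_def)
    with i(2) show "head G i \<in> {v. f v \<le> f v0}"
      by (simp add: coboundary_def)
  qed simp
  moreover have "verts G \<subseteq> {v. f v0 \<le> f v}"
  proof (rule subset_trans[OF spanning_arborescence_reaches_all[OF B(2)] reach_least])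
    fix i assume i: "i \<in> arcs G - B'" "tail G i \<in> {v. f v0 \<le> f v}"
    then have "0 \<le> coboundary G f i"
      using bspec[OF f, of i] w by (force simp: weights_on_def)
    with i(2) show "head G i \<in> {v. f v0 \<le> f v}"
      by (simp add: coboundary_def)
  qed simp
  ultimately have "f v = f v0" if "v \<in> verts G" for v
    using that by (blast intro: antisym)
  then have "coboundary G f e = 0"
    using e by (simp add: coboundary_def)
  then show ?thesis
    using bspec[OF f e] by simp
qed

end

theorem theorem4p1:
  fixes G :: "('v, 'e) pre_digraph"
    and a :: "'e \<Rightarrow> real ^ 'n"
    and v0 :: 'v
    and D :: "'e set set"
  assumes "eulerian_digraph G"
    and "totally_unimodular (arcs G) a"
    and "represents_oriented_dual G a"
    and "v0 \<in> verts G"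
  defines "D \<equiv> {B. B \<subseteq> arcs G \<and> spanning_arborescence G v0 (arcs G - B)}"
  shows "triangulation_of (root_polytope (arcs G) a) D (Delta a)"
proof -
  interpret fin_digraph G
    using assms(1) by (simp add: eulerian_digraph_def)
  interpret oriented_dual G a
    using assms(1-3) by unfold_locales (simp_all add: eulerian_digraph_def)
  have "unique_coordinates (arcs G) a D"
  proof
    show "B \<subseteq> arcs G" if "B \<in> D" for B
      using that by (simp add: D_def)
    show "a e \<in> affine hull (a ` B)" if "B \<in> D" "e \<in> arcs G" for B e
      using cotree_affinely_spanning[OF assms(1), of B v0 e] that by (simp add: D_def)
    show "\<exists>B\<in>D. \<exists>x'. weights_on (arcs G) B x' \<and> sum x' (arcs G) = sum x (arcs G) \<and>
        (\<Sum>e\<in>arcs G. x' e *\<^sub>R a e) = (\<Sum>e\<in>arcs G. x e *\<^sub>R a e)"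
      if "weights_on (arcs G) (arcs G) x" for x
      unfolding D_def by (rule cotree_simplices_cover[OF assms(1,4) that]) blast
    show "x e = x' e"
      if "B \<in> D" "B' \<in> D" "weights_on (arcs G) B x" "weights_on (arcs G) B' x'"
        "(\<Sum>e\<in>arcs G. x e *\<^sub>R a e) = (\<Sum>e\<in>arcs G. x' e *\<^sub>R a e)" "e \<in> arcs G" for B B' x x' e
      using cotree_coordinates_unique[of v0 B B' x x' e] that by (simp add: D_def)
  qed simp
  then show ?thesis
    by (rule unique_coordinates.triangulation_of_root_polytope)
qed

end
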